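(* Let $K$ be a field, $Q$ a finite directed graph, and $R=KQ$ the path algebra, with its positive gradation $R=\bigoplus_{p\in\mathbb{N}}R_p$ by lengths of paths. Let $\mathcal{B}$ be the $K$-basis of $R$ consisting of all finite directed paths and let $\succeq_{gr}$ be a graded monomial ordering on $\mathcal{B}$. Let $I$ be a two-sided ideal of $R$, let $\mathcal{G}$ be a Gröbner basis for $I$ with respect to $\succeq_{gr}$, and let $A=R/I$ with the filtration $F_pA=(F_pR+I)/I$, where $F_pR=\bigoplus_{i\le p}R_i$. Then the following statements hold. (i) $\langle\mathbf{LH}(I)\rangle=\langle\mathbf{LH}(\mathcal{G})\rangle$, and hence $G(A)\cong R/\langle\mathbf{LH}(\mathcal{G})\rangle$; that is, the algebra $A$ has the general PBW property (with respect to the generating set $\mathcal{G}$ of $I$). (ii) $\langle I^*\rangle=\langle\mathcal{G}^*\rangle$, and hence $\widetilde{A}\cong R[t]/\langle\mathcal{G}^*\rangle$.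
   Context: The path algebra $KQ$ has as $K$-basis the finite directed paths of $Q$ (vertices being paths of length $0$), with multiplication induced by concatenation of paths (zero if not composable). A graded monomial ordering on $\mathcal{B}$ is a well-ordering that is compatible with multiplication ($u\succ v$ implies $wus\succ wvs$ whenever both products are nonzero, and $wus\succeq u$ whenever $wus\ne0$) and preserves the gradation (a path of larger length is larger). For nonzero $f=\sum\lambda_iu_i$ with $\lambda_i\in K$ and distinct $u_i\in\mathcal{B}$, $\mathbf{LM}(f)=\max\{u_i\mid\lambda_i\ne0\}$ is the leading monomial. For a subset $S$, $\mathbf{LM}(S)$ is the set of leading monomials of the (nonzero) elements of $S$ and $\langle\mathbf{LM}(S)\rangle$ the two-sided ideal it generates. A subset $\mathcal{G}\subset I$ is a Gröbner basis for $I$ if $\langle\mathbf{LM}(I)\rangle=\langle\mathbf{LM}(\mathcal{G})\rangle$. For nonzero $f=f_p+f_{p-1}+\cdots+f_{p-s}$ with $f_{p-j}\in R_{p-j}$ and $f_p\ne0$: $d(f)=p$, $\mathbf{LH}(f)=f_p$, and $f^*=f_p+tf_{p-1}+\cdots+t^sf_{p-s}\in R[t]$, where $t$ is a variable commuting with $R$ ($\mathbf{LH}(0)=0$, $0^*=0$). $R[t]$ is graded by $R[t]_p=\{\sum_{i+j=p}r_it^j\mid r_i\in R_i,\ j\ge 0\}$. For a subset $S\subseteq R$, $\langle\mathbf{LH}(S)\rangle$ is the two-sided ideal of $R$ generated by $\{\mathbf{LH}(f)\mid f\in S\}$, and $\langle S^*\rangle$ is the two-sided ideal of $R[t]$ generated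 by $S^*=\{f^*\mid f\in S\}$. $G(A)=\bigoplus_pF_pA/F_{p-1}A$ is the associated graded algebra and $\widetilde{A}=\bigoplus_pF_pA$ the Rees algebra of $A$; the isomorphisms are of graded algebras. General PBW property: for a generating set $\mathcal{F}$ of $I$, $A=R/I$ has the general PBW property if one of the following equivalent conditions is satisfied: (1) the natural graded epimorphism $\rho:R/\langle\mathbf{LH}(\mathcal{F})\rangle\to G(A)$, induced by the natural graded epimorphism $R\to G(A)$ given in degree $p$ by $R_p\to F_pR/((I\cap F_pR)+F_{p-1}R)\cong G(A)_p$, is an isomorphism; (2) $\langle\mathbf{LH}(I)\rangle=\langle\mathbf{LH}(\mathcal{F})\rangle$; (3) every $f\in I$ can be written $f=\sum_jg_jf_jh_j$ with $g_j,h_j\in R$, $f_j\in\mathcal{F}$ and $d(g_j)+d(f_j)+d(h_j)\le d(f)$ whenever $g_jf_jh_j\ne0$; (4) $\langle I^*\rangle=\langle\mathcal{F}^*\rangle$. *)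

theory Defs
  imports
    "Graph_Theory.Arc_Walk"
    "HOL-Library.Poly_Mapping"
    "HOL-Algebra.UnivPoly"
    "HOL-Algebra.QuotRing"
begin

section \<open>Paths and the path algebra\<close>

text \<open>
  A path is a pair of its start vertex and its list of arcs, so that the vertices are the
  paths \<open>(v, [])\<close> of length 0.
\<close>

type_synonym ('v, 'e) path = "'v \<times> 'e list"

definition paths :: "('v, 'e) pre_digraph \<Rightarrow> ('v, 'e) path set" where
  "paths Q = {(u, es). \<exists>v. pre_digraph.awalk Q u es v}"

definition path_length :: "('v, 'e) path \<Rightarrow> nat" where
  "path_length u = length (snd u)"

definition path_source :: "('v, 'e) path \<Rightarrow> 'v" where
  "path_source u = fst u"

definition path_target :: "('v, 'e) pre_digraph \<Rightarrow> ('v, 'e) path \<Rightarrow> 'v" where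
  "path_target Q u = last (pre_digraph.awalk_verts Q (fst u) (snd u))"

text \<open>
  Products are read from left to right: \<open>u v\<close> is first \<open>u\<close>, then \<open>v\<close>. It is nonzero in the path
  algebra iff \<open>composable Q u v\<close>, and \<open>path_concat u v\<close> is only meaningful in that case.
\<close>

definition composable :: "('v, 'e) pre_digraph \<Rightarrow> ('v, 'e) path \<Rightarrow> ('v, 'e) path \<Rightarrow> bool" where
  "composable Q u v \<longleftrightarrow> path_target Q u = path_source v"

definition path_concat :: "('v, 'e) path \<Rightarrow> ('v, 'e) path \<Rightarrow> ('v, 'e) path" where
  "path_concat u v = (fst u, snd u @ snd v)"

text \<open>
  Algebras over the field \<open>'k\<close> are records of type \<open>('k, _) module\<close>, i.e. rings with a scalar
  multiplication; the library locale \<^locale>\<open>algebra\<close> is not used since it requires commutativity.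
\<close>

definition path_algebra ::
    "('v, 'e) pre_digraph \<Rightarrow> ('k::field, ('v, 'e) path \<Rightarrow>\<^sub>0 'k) module" where
  "path_algebra Q =
    \<lparr>carrier = {f. Poly_Mapping.keys f \<subseteq> paths Q},
     mult = (\<lambda>f g. \<Sum>u\<in>Poly_Mapping.keys f. \<Sum>v\<in>Poly_Mapping.keys g.
               if composable Q u v
               then Poly_Mapping.single (path_concat u v)
                      (Poly_Mapping.lookup f u * Poly_Mapping.lookup g v)
               else 0),
     one = (\<Sum>v\<in>verts Q. Poly_Mapping.single (v, []) 1),
     zero = 0,
     add = (+),
     smult = (\<lambda>c. Poly_Mapping.map ((*) c))\<rparr>"


section \<open>Gradation by path length\<close>

definition homogeneous_part :: "('v, 'e) pre_digraph \<Rightarrow> nat \<Rightarrow> (('v, 'e) path \<Rightarrow>\<^sub>0 'k::field) set" where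
  "homogeneous_part Q p =
    {f \<in> carrier (path_algebra Q). \<forall>u\<in>Poly_Mapping.keys f. path_length u = p}"

definition path_filtration :: "('v, 'e) pre_digraph \<Rightarrow> nat \<Rightarrow> (('v, 'e) path \<Rightarrow>\<^sub>0 'k::field) set" where
  "path_filtration Q p =
    {f \<in> carrier (path_algebra Q). \<forall>u\<in>Poly_Mapping.keys f. path_length u \<le> p}"

definition hcomp :: "nat \<Rightarrow> (('v, 'e) path \<Rightarrow>\<^sub>0 'k::field) \<Rightarrow> ('v, 'e) path \<Rightarrow>\<^sub>0 'k" where
  "hcomp p f = (\<Sum>u\<in>{u \<in> Poly_Mapping.keys f. path_length u = p}.
                  Poly_Mapping.single u (Poly_Mapping.lookup f u))"

text \<open>The value \<open>pdeg 0\<close> is unspecified.\<close>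

definition pdeg :: "(('v, 'e) path \<Rightarrow>\<^sub>0 'k::field) \<Rightarrow> nat" where
  "pdeg f = Max (path_length ` Poly_Mapping.keys f)"

definition LH :: "(('v, 'e) path \<Rightarrow>\<^sub>0 'k::field) \<Rightarrow> ('v, 'e) path \<Rightarrow>\<^sub>0 'k" where
  "LH f = (if f = 0 then 0 else hcomp (pdeg f) f)"


section \<open>Groebner bases\<close>

text \<open>\<open>(v, u) \<in> r\<close> means that \<open>v\<close> is at most \<open>u\<close>.\<close>

definition graded_monomial_ordering :: "('v, 'e) pre_digraph \<Rightarrow> ('v, 'e) path rel \<Rightarrow> bool" where
  "graded_monomial_ordering Q r \<longleftrightarrow>
    well_order_on (paths Q) r \<and>
    (\<forall>u\<in>paths Q. \<forall>v\<in>paths Q. \<forall>w\<in>paths Q. \<forall>s\<in>paths Q.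
       (v, u) \<in> r \<and> v \<noteq> u \<and>
       composable Q w u \<and> composable Q (path_concat w u) s \<and>
       composable Q w v \<and> composable Q (path_concat w v) s \<longrightarrow>
       (path_concat (path_concat w v) s, path_concat (path_concat w u) s) \<in> r \<and>
       path_concat (path_concat w v) s \<noteq> path_concat (path_concat w u) s) \<and>
    (\<forall>u\<in>paths Q. \<forall>w\<in>paths Q. \<forall>s\<in>paths Q.
       composable Q w u \<and> composable Q (path_concat w u) s \<longrightarrow>
       (u, path_concat (path_concat w u) s) \<in> r) \<and>
    (\<forall>u\<in>paths Q. \<forall>v\<in>paths Q. path_length v < path_length u \<longrightarrow> (v, u) \<in> r)"

definition LM :: "('v, 'e) path rel \<Rightarrow> (('v, 'e) path \<Rightarrow>\<^sub>0 'k::field) \<Rightarrow> ('v, 'e) path" where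
  "LM r f = (THE u. u \<in> Poly_Mapping.keys f \<and> (\<forall>v\<in>Poly_Mapping.keys f. (v, u) \<in> r))"

definition LM_set ::
    "('v, 'e) path rel \<Rightarrow> (('v, 'e) path \<Rightarrow>\<^sub>0 'k::field) set \<Rightarrow> (('v, 'e) path \<Rightarrow>\<^sub>0 'k) set" where
  "LM_set r S = {Poly_Mapping.single (LM r f) 1 | f. f \<in> S \<and> f \<noteq> 0}"

definition groebner_basis ::
    "('v, 'e) pre_digraph \<Rightarrow> ('v, 'e) path rel \<Rightarrow> (('v, 'e) path \<Rightarrow>\<^sub>0 'k::field) set \<Rightarrow>
     (('v, 'e) path \<Rightarrow>\<^sub>0 'k) set \<Rightarrow> bool" where
  "groebner_basis Q r I \<G> \<longleftrightarrow>
    \<G> \<subseteq> I \<and> Idl\<^bsub>path_algebra Q\<^esub> (LM_set r I) = Idl\<^bsub>path_algebra Q\<^esub> (LM_set r \<G>)"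


section \<open>Graded algebras, quotients, associated graded and Rees algebras\<close>

definition graded_iso ::
    "('k, 'a) module \<Rightarrow> (nat \<Rightarrow> 'a set) \<Rightarrow> ('k, 'b) module \<Rightarrow> (nat \<Rightarrow> 'b set) \<Rightarrow> ('a \<Rightarrow> 'b) set" where
  "graded_iso X gX Y gY =
    {h \<in> ring_iso X Y. (\<forall>c. \<forall>x\<in>carrier X. h (c \<odot>\<^bsub>X\<^esub> x) = c \<odot>\<^bsub>Y\<^esub> h x) \<and> (\<forall>p. h ` gX p = gY p)}"

definition graded_isomorphic ::
    "('k, 'a) module \<Rightarrow> (nat \<Rightarrow> 'a set) \<Rightarrow> ('k, 'b) module \<Rightarrow> (nat \<Rightarrow> 'b set) \<Rightarrow> bool" where
  "graded_isomorphic X gX Y gY \<longleftrightarrow> graded_iso X gX Y gY \<noteq> {}"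

definition quot_algebra :: "('k, 'a) module \<Rightarrow> 'a set \<Rightarrow> ('k, 'a set) module" where
  "quot_algebra X J = ring.extend (X Quot J) (module.fields (\<lambda>c C. \<Union>x\<in>C. J +>\<^bsub>X\<^esub> (c \<odot>\<^bsub>X\<^esub> x)))"

definition quot_grading :: "('k, 'a) module \<Rightarrow> 'a set \<Rightarrow> (nat \<Rightarrow> 'a set) \<Rightarrow> nat \<Rightarrow> 'a set set" where
  "quot_grading X J gX p = (\<lambda>x. J +>\<^bsub>X\<^esub> x) ` gX p"

text \<open>\<open>filt_pred X F p\<close> is \<open>F\<^sub>p\<^sub>-\<^sub>1\<close>, with \<open>F\<^sub>-\<^sub>1 = 0\<close>.\<close>

definition filt_pred :: "('k, 'a) module \<Rightarrow> (nat \<Rightarrow> 'a set) \<Rightarrow> nat \<Rightarrow> 'a set" where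
  "filt_pred X F p = (if p = 0 then {\<zero>\<^bsub>X\<^esub>} else F (p - 1))"

text \<open>
  The external direct sum of the \<open>F\<^sub>p/F\<^sub>p\<^sub>-\<^sub>1\<close>, as sequences of cosets of which almost all are zero.
  Products and scalar multiples are formed on representatives, as in \<^const>\<open>rcoset_mult\<close>.
\<close>

definition assoc_graded :: "('k, 'a) module \<Rightarrow> (nat \<Rightarrow> 'a set) \<Rightarrow> ('k, nat \<Rightarrow> 'a set) module" where
  "assoc_graded X F =
    \<lparr>carrier = {x. (\<forall>p. x p \<in> (\<lambda>a. filt_pred X F p +>\<^bsub>X\<^esub> a) ` F p) \<and>
                   finite {p. x p \<noteq> filt_pred X F p}},
     mult = (\<lambda>x y p. \<Union>a\<in>Pi UNIV x. \<Union>b\<in>Pi UNIV y.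
               filt_pred X F p +>\<^bsub>X\<^esub> (\<Oplus>\<^bsub>X\<^esub>i\<in>{..p}. a i \<otimes>\<^bsub>X\<^esub> b (p - i))),
     one = (\<lambda>p. filt_pred X F p +>\<^bsub>X\<^esub> (if p = 0 then \<one>\<^bsub>X\<^esub> else \<zero>\<^bsub>X\<^esub>)),
     zero = (\<lambda>p. filt_pred X F p),
     add = (\<lambda>x y p. x p <+>\<^bsub>X\<^esub> y p),
     smult = (\<lambda>c x p. \<Union>a\<in>x p. filt_pred X F p +>\<^bsub>X\<^esub> (c \<odot>\<^bsub>X\<^esub> a))\<rparr>"

definition assoc_graded_part :: "('k, 'a) module \<Rightarrow> (nat \<Rightarrow> 'a set) \<Rightarrow> nat \<Rightarrow> (nat \<Rightarrow> 'a set) set" where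
  "assoc_graded_part X F p =
    {x \<in> carrier (assoc_graded X F). \<forall>i. i \<noteq> p \<longrightarrow> x i = filt_pred X F i}"

text \<open>
  The external direct sum of the \<open>F\<^sub>p\<close>. Its ring operations are those of polynomials with the
  \<open>p\<close>-th coefficient in \<open>F\<^sub>p\<close>. Note that \<^const>\<open>UP\<close> does not need commutative coefficients and
  that its variable commutes with them.
\<close>

definition rees_algebra :: "('k, 'a) module \<Rightarrow> (nat \<Rightarrow> 'a set) \<Rightarrow> ('k, nat \<Rightarrow> 'a) module" where
  "rees_algebra X F =
    \<lparr>carrier = {x \<in> carrier (UP X). \<forall>p. x p \<in> F p},
     mult = mult (UP X), one = one (UP X), zero = zero (UP X), add = add (UP X),
     smult = (\<lambda>c x p. c \<odot>\<^bsub>X\<^esub> x p)\<rparr>"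

definition rees_part :: "('k, 'a) module \<Rightarrow> (nat \<Rightarrow> 'a set) \<Rightarrow> nat \<Rightarrow> (nat \<Rightarrow> 'a) set" where
  "rees_part X F p = {x \<in> carrier (rees_algebra X F). \<forall>i. i \<noteq> p \<longrightarrow> x i = \<zero>\<^bsub>X\<^esub>}"

text \<open>\<open>X[t]\<close> as an algebra over \<open>'k\<close>; the scalars of \<^const>\<open>UP\<close> itself are those of \<open>X\<close>.\<close>

definition poly_algebra :: "('k, 'a) module \<Rightarrow> ('k, nat \<Rightarrow> 'a) module" where
  "poly_algebra X =
    \<lparr>carrier = carrier (UP X),
     mult = mult (UP X), one = one (UP X), zero = zero (UP X), add = add (UP X),
     smult = (\<lambda>c x j. c \<odot>\<^bsub>X\<^esub> x j)\<rparr>"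

text \<open>The coefficient of \<open>t\<^sup>j\<close> in a homogeneous element of degree \<open>p\<close> is some \<open>r\<^sub>p\<^sub>-\<^sub>j \<in> X\<^sub>p\<^sub>-\<^sub>j\<close>.\<close>

definition poly_grading :: "('k, 'a) module \<Rightarrow> (nat \<Rightarrow> 'a set) \<Rightarrow> nat \<Rightarrow> (nat \<Rightarrow> 'a) set" where
  "poly_grading X gX p = {(\<lambda>j. if j \<le> p then r (p - j) else \<zero>\<^bsub>X\<^esub>) | r. \<forall>i. r i \<in> gX i}"


section \<open>Homogenization and the general PBW property\<close>

text \<open>The coefficient of \<open>t\<^sup>j\<close> in \<open>homogenization f\<close> is the component of \<open>f\<close> of degree \<open>pdeg f - j\<close>.\<close>

definition homogenization :: "(('v, 'e) path \<Rightarrow>\<^sub>0 'k::field) \<Rightarrow> nat \<Rightarrow> ('v, 'e) path \<Rightarrow>\<^sub>0 'k" where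
  "homogenization f = (\<lambda>j. if f \<noteq> 0 \<and> j \<le> pdeg f then hcomp (pdeg f - j) f else 0)"

definition quot_filtration ::
    "('v, 'e) pre_digraph \<Rightarrow> (('v, 'e) path \<Rightarrow>\<^sub>0 'k::field) set \<Rightarrow> nat \<Rightarrow>
     (('v, 'e) path \<Rightarrow>\<^sub>0 'k) set set" where
  "quot_filtration Q I p =
    (\<lambda>x. I +>\<^bsub>path_algebra Q\<^esub> x) ` (path_filtration Q p <+>\<^bsub>path_algebra Q\<^esub> I)"

text \<open>
  The natural graded epimorphism onto the associated graded algebra of \<open>A = R/I\<close>: on \<open>R\<^sub>p\<close> it sends
  \<open>f\<close> to the class of \<open>f + I\<close> in \<open>F\<^sub>pA/F\<^sub>p\<^sub>-\<^sub>1A\<close>, which corresponds to the class of \<open>f\<close> under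
  \<open>F\<^sub>pR/((I \<inter> F\<^sub>pR) + F\<^sub>p\<^sub>-\<^sub>1R) \<cong> F\<^sub>pA/F\<^sub>p\<^sub>-\<^sub>1A\<close>.
\<close>

definition natural_map ::
    "('v, 'e) pre_digraph \<Rightarrow> (('v, 'e) path \<Rightarrow>\<^sub>0 'k::field) set \<Rightarrow> (('v, 'e) path \<Rightarrow>\<^sub>0 'k) \<Rightarrow>
     nat \<Rightarrow> (('v, 'e) path \<Rightarrow>\<^sub>0 'k) set set" where
  "natural_map Q I f =
    (let R = path_algebra Q; A = quot_algebra R I
     in (\<lambda>p. filt_pred A (quot_filtration Q I) p +>\<^bsub>A\<^esub> (I +>\<^bsub>R\<^esub> hcomp p f)))"

text \<open>
  The map induced by \<^const>\<open>natural_map\<close> on cosets; it is constant on the cosets of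
  \<open>\<langle>LH \<F>\<rangle>\<close> whenever \<open>\<F> \<subseteq> I\<close>.
\<close>

definition natural_rho ::
    "('v, 'e) pre_digraph \<Rightarrow> (('v, 'e) path \<Rightarrow>\<^sub>0 'k::field) set \<Rightarrow> (('v, 'e) path \<Rightarrow>\<^sub>0 'k) set \<Rightarrow>
     nat \<Rightarrow> (('v, 'e) path \<Rightarrow>\<^sub>0 'k) set set" where
  "natural_rho Q I C = the_elem (natural_map Q I ` C)"

text \<open>
  The four conditions after the first conjunct (\<open>\<F>\<close> generates \<open>I\<close>) are equivalent ways to state
  the property; all of them are required, so that the definition does not depend on knowing that
  they are equivalent.
\<close>

definition general_PBW ::
    "('v, 'e) pre_digraph \<Rightarrow> (('v, 'e) path \<Rightarrow>\<^sub>0 'k::field) set \<Rightarrow> (('v, 'e) path \<Rightarrow>\<^sub>0 'k) set \<Rightarrow> bool"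
  where
  "general_PBW Q I \<F> \<longleftrightarrow>
    (let R = path_algebra Q; Rt = poly_algebra R; A = quot_algebra R I; FA = quot_filtration Q I;
         L = Idl\<^bsub>R\<^esub> (LH ` \<F>)
     in Idl\<^bsub>R\<^esub> \<F> = I \<and>
        natural_rho Q I \<in> graded_iso (quot_algebra R L) (quot_grading R L (homogeneous_part Q))
                                     (assoc_graded A FA) (assoc_graded_part A FA) \<and>
        Idl\<^bsub>R\<^esub> (LH ` I) = L \<and>
        (\<forall>f\<in>I. f \<noteq> 0 \<longrightarrow>
           (\<exists>n::nat. \<exists>g \<phi> h.
              (\<forall>j<n. g j \<in> carrier R \<and> \<phi> j \<in> \<F> \<and> h j \<in> carrier R) \<and>
              f = (\<Oplus>\<^bsub>R\<^esub>j\<in>{..<n}. g j \<otimes>\<^bsub>R\<^esub> \<phi> j \<otimes>\<^bsub>R\<^esub> h j) \<and>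
              (\<forall>j<n. g j \<otimes>\<^bsub>R\<^esub> \<phi> j \<otimes>\<^bsub>R\<^esub> h j \<noteq> \<zero>\<^bsub>R\<^esub> \<longrightarrow>
                 pdeg (g j) + pdeg (\<phi> j) + pdeg (h j) \<le> pdeg f))) \<and>
        Idl\<^bsub>Rt\<^esub> (homogenization ` I) = Idl\<^bsub>Rt\<^esub> (homogenization ` \<F>))"


section \<open>The path algebra of a finite digraph is a ring\<close>

lemma last_awalk_verts:
  "last (pre_digraph.awalk_verts Q u es) = (if es = [] then u else head Q (last es))"
  by (simp add: pre_digraph.awalk_verts_conv)

lemma path_target_alt:
  "path_target Q u = (if snd u = [] then fst u else head Q (last (snd u)))"
  by (simp add: path_target_def last_awalk_verts)

lemma path_concat_in_paths:
  assumes "u \<in> paths Q" "v \<in> paths Q" "composable Q u v"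
  shows "path_concat u v \<in> paths Q"
proof -
  have cas_app: "pre_digraph.cas Q a (p @ q) c" if "pre_digraph.cas Q a p b" "pre_digraph.cas Q b q c" for a b c p q
    using that by (induction p arbitrary: a) (auto simp: pre_digraph.cas.simps)
  have cas_end: "b = last (pre_digraph.awalk_verts Q a p)" if "pre_digraph.cas Q a p b" for a b p
    using that by (induction p arbitrary: a)
      (auto simp: pre_digraph.cas.simps last_awalk_verts)
  from assms obtain b c where "pre_digraph.awalk Q (fst u) (snd u) b" "pre_digraph.awalk Q (fst v) (snd v) c"
    by (auto simp: paths_def)
  then have "pre_digraph.awalk Q (fst u) (snd u @ snd v) c"
    using assms(3) cas_end[of "fst u" "snd u" b] cas_app[of "fst u" "snd u" b "snd v" c]
    by (auto simp: pre_digraph.awalk_def composable_def path_target_def path_source_def)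
  then show ?thesis by (auto simp: paths_def path_concat_def)
qed

definition path_mult_term ::
    "('v, 'e) pre_digraph \<Rightarrow> ('v, 'e) path \<Rightarrow> ('v, 'e) path \<Rightarrow> 'k::field \<Rightarrow> ('v, 'e) path \<Rightarrow>\<^sub>0 'k"
  where
  "path_mult_term Q u v c = (if composable Q u v then Poly_Mapping.single (path_concat u v) c else 0)"

lemma mult_path_algebra_superset:
  assumes "finite U" "finite V" "Poly_Mapping.keys f \<subseteq> U" "Poly_Mapping.keys g \<subseteq> V"
  shows "f \<otimes>\<^bsub>path_algebra Q\<^esub> g = (\<Sum>u\<in>U. \<Sum>v\<in>V. path_mult_term Q u v
           (Poly_Mapping.lookup f u * Poly_Mapping.lookup g v))"
proof -
  have "f \<otimes>\<^bsub>path_algebra Q\<^esub> g = (\<Sum>u\<in>Poly_Mapping.keys f. \<Sum>v\<in>Poly_Mapping.keys g. path_mult_term Q u v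
           (Poly_Mapping.lookup f u * Poly_Mapping.lookup g v))"
    by (simp add: path_algebra_def path_mult_term_def)
  also have "\<dots> = (\<Sum>u\<in>Poly_Mapping.keys f. \<Sum>v\<in>V. path_mult_term Q u v
           (Poly_Mapping.lookup f u * Poly_Mapping.lookup g v))"
    using assms by (intro sum.cong[OF refl] sum.mono_neutral_left)
      (auto simp: path_mult_term_def in_keys_iff)
  also have "\<dots> = (\<Sum>u\<in>U. \<Sum>v\<in>V. path_mult_term Q u v
           (Poly_Mapping.lookup f u * Poly_Mapping.lookup g v))"
    using assms by (intro sum.mono_neutral_left)
      (auto simp: path_mult_term_def in_keys_iff intro!: sum.neutral)
  finally show ?thesis .
qed

lemma path_mult_term_add: "path_mult_term Q u v (a + b) = path_mult_term Q u v a + path_mult_term Q u v b"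
  by (simp add: path_mult_term_def single_add)

lemma mult_path_algebra_distr:
  "(f + f') \<otimes>\<^bsub>path_algebra Q\<^esub> g = (f \<otimes>\<^bsub>path_algebra Q\<^esub> g) + (f' \<otimes>\<^bsub>path_algebra Q\<^esub> g)"
  "g \<otimes>\<^bsub>path_algebra Q\<^esub> (f + f') = (g \<otimes>\<^bsub>path_algebra Q\<^esub> f) + (g \<otimes>\<^bsub>path_algebra Q\<^esub> f')"
proof -
  let ?F = "Poly_Mapping.keys f \<union> Poly_Mapping.keys f'" and ?G = "Poly_Mapping.keys g"
  have k: "Poly_Mapping.keys (f + f') \<subseteq> ?F" by (rule Poly_Mapping.keys_add)
  show "(f + f') \<otimes>\<^bsub>path_algebra Q\<^esub> g = (f \<otimes>\<^bsub>path_algebra Q\<^esub> g) + (f' \<otimes>\<^bsub>path_algebra Q\<^esub> g)"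
    using k by (subst (1 2 3) mult_path_algebra_superset[of ?F ?G])
      (auto simp: lookup_add distrib_right path_mult_term_add sum.distrib)
  show "g \<otimes>\<^bsub>path_algebra Q\<^esub> (f + f') = (g \<otimes>\<^bsub>path_algebra Q\<^esub> f) + (g \<otimes>\<^bsub>path_algebra Q\<^esub> f')"
    using k by (subst (1 2 3) mult_path_algebra_superset[of ?G ?F])
      (auto simp: lookup_add distrib_left path_mult_term_add sum.distrib)
qed

lemma mult_path_algebra_zero:
  "0 \<otimes>\<^bsub>path_algebra Q\<^esub> g = 0" "g \<otimes>\<^bsub>path_algebra Q\<^esub> 0 = 0"
  by (simp_all add: path_algebra_def)

lemma mult_path_algebra_single:
  "Poly_Mapping.single u a \<otimes>\<^bsub>path_algebra Q\<^esub> Poly_Mapping.single v b = path_mult_term Q u v (a * b)"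
  by (subst mult_path_algebra_superset[of "{u}" "{v}"]) auto

lemma mult_path_algebra_sum:
  "(\<Sum>x\<in>X. f x) \<otimes>\<^bsub>path_algebra Q\<^esub> g = (\<Sum>x\<in>X. f x \<otimes>\<^bsub>path_algebra Q\<^esub> g)"
  "g \<otimes>\<^bsub>path_algebra Q\<^esub> (\<Sum>x\<in>X. f x) = (\<Sum>x\<in>X. g \<otimes>\<^bsub>path_algebra Q\<^esub> f x)"
  by (induction X rule: infinite_finite_induct)
    (simp_all add: mult_path_algebra_zero mult_path_algebra_distr)

lemma path_sum_singles:
  "f = (\<Sum>u\<in>Poly_Mapping.keys f. Poly_Mapping.single u (Poly_Mapping.lookup f u))"
proof (rule poly_mapping_eqI)
  fix k
  have "Poly_Mapping.lookup (\<Sum>u\<in>Poly_Mapping.keys f. Poly_Mapping.single u (Poly_Mapping.lookup f u)) k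
      = (\<Sum>u\<in>Poly_Mapping.keys f. if u = k then Poly_Mapping.lookup f u else 0)"
    by (auto simp: lookup_sum lookup_single when_def intro!: sum.cong)
  then show "Poly_Mapping.lookup f k =
      Poly_Mapping.lookup (\<Sum>u\<in>Poly_Mapping.keys f. Poly_Mapping.single u (Poly_Mapping.lookup f u)) k"
    by (simp add: in_keys_iff)
qed

lemma mult_path_algebra_assoc:
  fixes f g h :: "('v, 'e) path \<Rightarrow>\<^sub>0 'a::field"
  shows "(f \<otimes>\<^bsub>path_algebra Q\<^esub> g) \<otimes>\<^bsub>path_algebra Q\<^esub> h = f \<otimes>\<^bsub>path_algebra Q\<^esub> (g \<otimes>\<^bsub>path_algebra Q\<^esub> h)"
proof -
  have s: "(Poly_Mapping.single u a \<otimes>\<^bsub>path_algebra Q\<^esub> Poly_Mapping.single v b) \<otimes>\<^bsub>path_algebra Q\<^esub> Poly_Mapping.single w c =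
     Poly_Mapping.single u a \<otimes>\<^bsub>path_algebra Q\<^esub> (Poly_Mapping.single v b \<otimes>\<^bsub>path_algebra Q\<^esub> Poly_Mapping.single w c)"
    for u v w and a b c :: 'a
    unfolding mult_path_algebra_single
    by (auto simp: path_mult_term_def mult_path_algebra_zero mult_path_algebra_single composable_def
        path_target_alt path_concat_def path_source_def mult.assoc split: if_splits)
  show ?thesis
    by (subst (1 2) path_sum_singles[of f], subst (1 2) path_sum_singles[of g], subst (1 2) path_sum_singles[of h])
      (simp only: mult_path_algebra_sum s)
qed

lemma keys_sum_subset:
  assumes "\<And>x. x \<in> X \<Longrightarrow> Poly_Mapping.keys (f x) \<subseteq> P"
  shows "Poly_Mapping.keys (\<Sum>x\<in>X. f x) \<subseteq> P"
  using Poly_Mapping.keys_sum[of f X] assms by blast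

lemma mult_path_algebra_closed:
  assumes "Poly_Mapping.keys f \<subseteq> paths Q" "Poly_Mapping.keys g \<subseteq> paths Q"
  shows "Poly_Mapping.keys (f \<otimes>\<^bsub>path_algebra Q\<^esub> g) \<subseteq> paths Q"
  using assms
  unfolding mult_path_algebra_superset[OF finite_keys finite_keys subset_refl subset_refl]
  by (intro keys_sum_subset) (auto simp: path_mult_term_def intro: path_concat_in_paths)

lemma one_mult_path_algebra:
  fixes f :: "('v, 'e) path \<Rightarrow>\<^sub>0 'c::field"
  assumes "finite (verts Q)" "wf_digraph Q" "Poly_Mapping.keys f \<subseteq> paths Q"
  shows "\<one>\<^bsub>path_algebra Q\<^esub> \<otimes>\<^bsub>path_algebra Q\<^esub> f = f" "f \<otimes>\<^bsub>path_algebra Q\<^esub> \<one>\<^bsub>path_algebra Q\<^esub> = f"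
proof -
  have one: "\<one>\<^bsub>path_algebra Q\<^esub> = (\<Sum>v\<in>verts Q. Poly_Mapping.single (v, []) 1)"
    by (simp add: path_algebra_def)
  have p: "fst u \<in> verts Q" "path_target Q u \<in> verts Q" if "u \<in> paths Q" for u
  proof -
    from that obtain v where "pre_digraph.awalk Q (fst u) (snd u) v" by (auto simp: paths_def)
    then show "fst u \<in> verts Q" "path_target Q u \<in> verts Q"
      using assms(2) by (auto simp: pre_digraph.awalk_def path_target_alt wf_digraph.head_in_verts subset_iff)
  qed
  have L: "\<one>\<^bsub>path_algebra Q\<^esub> \<otimes>\<^bsub>path_algebra Q\<^esub> Poly_Mapping.single u a = Poly_Mapping.single u a"
    if "u \<in> paths Q" for u and a :: 'c
  proof -
    have "\<one>\<^bsub>path_algebra Q\<^esub> \<otimes>\<^bsub>path_algebra Q\<^esub> Poly_Mapping.single u a =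
       (\<Sum>v\<in>verts Q. if v = fst u then Poly_Mapping.single u a else 0)"
      unfolding one mult_path_algebra_sum mult_path_algebra_single
      by (intro sum.cong) (auto simp: path_mult_term_def composable_def path_target_alt path_concat_def path_source_def)
    then show ?thesis using p[OF that] assms(1) by simp
  qed
  have R: "Poly_Mapping.single u a \<otimes>\<^bsub>path_algebra Q\<^esub> \<one>\<^bsub>path_algebra Q\<^esub> = Poly_Mapping.single u a"
    if "u \<in> paths Q" for u and a :: 'c
  proof -
    have "Poly_Mapping.single u a \<otimes>\<^bsub>path_algebra Q\<^esub> \<one>\<^bsub>path_algebra Q\<^esub> =
       (\<Sum>v\<in>verts Q. if v = path_target Q u then Poly_Mapping.single u a else 0)"
      unfolding one mult_path_algebra_sum mult_path_algebra_single
      by (intro sum.cong) (auto simp: path_mult_term_def composable_def path_concat_def path_source_def)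
    then show ?thesis using p[OF that] assms(1) by simp
  qed
  have "\<one>\<^bsub>path_algebra Q\<^esub> \<otimes>\<^bsub>path_algebra Q\<^esub> f =
    (\<Sum>u\<in>Poly_Mapping.keys f. Poly_Mapping.single u (Poly_Mapping.lookup f u))"
    using assms(3) by (subst path_sum_singles[of f], unfold mult_path_algebra_sum) (auto intro!: sum.cong L)
  then show "\<one>\<^bsub>path_algebra Q\<^esub> \<otimes>\<^bsub>path_algebra Q\<^esub> f = f" by (simp flip: path_sum_singles)
  have "f \<otimes>\<^bsub>path_algebra Q\<^esub> \<one>\<^bsub>path_algebra Q\<^esub> =
    (\<Sum>u\<in>Poly_Mapping.keys f. Poly_Mapping.single u (Poly_Mapping.lookup f u))"
    using assms(3) by (subst path_sum_singles[of f], unfold mult_path_algebra_sum) (auto intro!: sum.cong R)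
  then show "f \<otimes>\<^bsub>path_algebra Q\<^esub> \<one>\<^bsub>path_algebra Q\<^esub> = f" by (simp flip: path_sum_singles)
qed

lemma ring_path_algebra:
  fixes Q :: "('v, 'e) pre_digraph"
  assumes "fin_digraph Q"
  shows "ring (path_algebra Q :: ('k::field, ('v, 'e) path \<Rightarrow>\<^sub>0 'k) module)"
proof -
  interpret fin_digraph Q by fact
  let ?R = "path_algebra Q :: ('k, ('v, 'e) path \<Rightarrow>\<^sub>0 'k) module"
  have sel: "carrier (?R) = {f. Poly_Mapping.keys f \<subseteq> paths Q}"
    "zero (?R) = 0" "add (?R) = (+)"
    by (simp_all add: path_algebra_def)
  have one: "Poly_Mapping.keys \<one>\<^bsub>?R\<^esub> \<subseteq> paths Q"
    unfolding path_algebra_def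
    by (auto intro!: keys_sum_subset simp: paths_def awalk_def cas.simps split: if_splits)
  show ?thesis
  proof (intro ringI abelian_groupI monoidI)
    fix x assume "x \<in> carrier (?R)"
    then show "\<exists>y\<in>carrier (?R). y \<oplus>\<^bsub>?R\<^esub> x = \<zero>\<^bsub>?R\<^esub>"
      by (intro bexI[of _ "- x"]) (auto simp: sel)
  next
    fix x y :: "('v, 'e) path \<Rightarrow>\<^sub>0 'k" assume "x \<in> carrier (?R)" "y \<in> carrier (?R)"
    then show "x \<oplus>\<^bsub>?R\<^esub> y \<in> carrier (?R)"
      "x \<otimes>\<^bsub>?R\<^esub> y \<in> carrier (?R)"
      using Poly_Mapping.keys_add[of x y] mult_path_algebra_closed[of x Q y] by (auto simp: sel)
  qed (use one one_mult_path_algebra[OF finite_verts wf_digraph_axioms] in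
       \<open>auto simp: sel mult_path_algebra_assoc mult_path_algebra_distr add.assoc add.commute\<close>)
qed

end

theory Submission
  imports Defs
begin

text \<open>
  Since the ordering is graded, cancelling the leading term of some \<open>f \<in> I\<close> with a multiple
  \<open>c w g s\<close> of a Groebner basis element \<open>g\<close> never leaves the degree of \<open>f\<close>, so \<open>f\<close> is a sum of terms
  \<open>c w g s\<close> with \<open>\<bar>w\<bar> + d(g) + \<bar>s\<bar> \<le> d(f)\<close>. Taking components of degree \<open>d(f)\<close>, respectively
  homogenizing, this puts \<open>LH(f)\<close> into \<open>\<langle>LH(\<G>)\<rangle>\<close> and \<open>f\<^sup>*\<close> into \<open>\<langle>\<G>\<^sup>*\<rangle>\<close>. The isomorphisms come
  from the homomorphism theorem: \<open>\<langle>LH(I)\<rangle>\<close> is the kernel of the natural map \<open>R \<rightarrow> G(A)\<close>, and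
  \<open>\<langle>I\<^sup>*\<rangle>\<close> is the kernel of the map from \<open>R[t]\<close> to the Rees algebra which in degree \<open>p\<close> puts \<open>t = 1\<close>
  and reduces modulo \<open>I\<close>.
\<close>

section \<open>Quotients of algebras and associated graded rings\<close>

text \<open>Reduction needs the leading path of \<open>f\<close> to be literally a product
  \<open>w (LM g) s\<close>, while the hypothesis only places it in a two-sided ideal generated by
  paths. The gap is closed by observing that the elements all of whose paths are multiples of the
  generators already form an ideal, so a single path in the generated ideal must be such a multiple.
  What is peculiar to path algebras is that products of paths may vanish: each multiplication by
  \<open>w\<close> and \<open>s\<close> carries composability conditions, and cancellation works
  because a path composable with \<open>w\<close> on the right has its start fixed by
  \<open>w\<close>.

  Degrees are controlled by a bound \<open>p\<close> kept separate from the degree of the element.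
  Taking components of degree \<open>p\<close> and homogenizing to degree \<open>p\<close> are
  additive, whereas \<open>LH\<close> and \<open>homogenization\<close> are not, so sums can be
  treated term by term. Both isomorphisms are built for the ideals generated by all of
  \<open>I\<close>, where the kernel can be computed; the Groebner basis enters through the equality
  of ideals.\<close>

lemma UN_eq_const: "a \<in> S \<Longrightarrow> (\<And>x. x \<in> S \<Longrightarrow> f x = B) \<Longrightarrow> (\<Union>x\<in>S. f x) = B"
  by auto

text \<open>The ring axioms see only these five fields, so they pass between records that differ in
  their scalar multiplication: from \<open>X Quot J\<close> to \<open>quot_algebra X J\<close>, and
  from \<open>UP R\<close> to \<open>poly_algebra R\<close>.\<close>

lemma ring_cong:
  assumes "ring S" "carrier T = carrier S" "mult T = mult S" "one T = one S"
    "zero T = zero S" "add T = add S"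
  shows "ring T"
proof -
  interpret S: ring S by fact
  show ?thesis
    by (intro ringI abelian_groupI monoidI)
      (use assms S.l_neg S.a_inv_closed in \<open>auto simp: S.a_ac S.m_assoc S.l_distr S.r_distr\<close>)
qed

lemma quot_algebra_simps:
  "carrier (quot_algebra X J) = a_rcosets\<^bsub>X\<^esub> J" "mult (quot_algebra X J) = rcoset_mult X J"
  "one (quot_algebra X J) = J +>\<^bsub>X\<^esub> \<one>\<^bsub>X\<^esub>" "zero (quot_algebra X J) = J"
  "add (quot_algebra X J) = set_add X"
  "smult (quot_algebra X J) = (\<lambda>c C. \<Union>x\<in>C. J +>\<^bsub>X\<^esub> (c \<odot>\<^bsub>X\<^esub> x))"
  by (simp_all add: quot_algebra_def FactRing_def ring.defs module.defs)

lemma carrier_quot_algebra: "carrier (quot_algebra X J) = (\<lambda>x. J +>\<^bsub>X\<^esub> x) ` carrier X"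
  by (auto simp: quot_algebra_simps A_RCOSETS_def')

lemma ring_quot_algebra: "ideal J X \<Longrightarrow> ring (quot_algebra X J)"
  by (rule ring_cong[OF ideal.quotient_is_ring]) (simp_all add: quot_algebra_simps FactRing_def)

lemma ring_hom_quot_algebra: "ideal J X \<Longrightarrow> (\<lambda>x. J +>\<^bsub>X\<^esub> x) \<in> ring_hom X (quot_algebra X J)"
  using ideal.rcos_ring_hom[of J X]
  by (simp add: ring_hom_def quot_algebra_simps FactRing_def)

lemma (in abelian_subgroup) a_rcos_eq_iff:
  assumes "x \<in> carrier G" "y \<in> carrier G"
  shows "H +> x = H +> y \<longleftrightarrow> x \<ominus> y \<in> H"
proof
  assume "H +> x = H +> y"
  then have "x \<in> H +> y" using a_rcos_self[OF assms(1)] by simp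
  then show "x \<ominus> y \<in> H" using assms a_rcos_module by (simp add: a_minus_def)
next
  assume "x \<ominus> y \<in> H"
  then have "x \<in> H +> y" using assms a_rcos_module by (simp add: a_minus_def)
  then show "H +> x = H +> y" using assms a_repr_independence' by metis
qed

text \<open>Two representatives of a coset differ by some \<open>j\<close> in \<open>J\<close>, and
  \<open>c\<close> times \<open>j\<close> stays in \<open>J\<close>; hence all members of the union
  that defines the scalar multiple are the same coset.\<close>

lemma smult_quot_algebra:
  assumes "ideal J X" "\<And>y. y \<in> carrier X \<Longrightarrow> c \<odot>\<^bsub>X\<^esub> y \<in> carrier X"
    "\<And>y. y \<in> J \<Longrightarrow> c \<odot>\<^bsub>X\<^esub> y \<in> J"
    "\<And>y z. y \<in> carrier X \<Longrightarrow> z \<in> carrier X \<Longrightarrow> c \<odot>\<^bsub>X\<^esub> (y \<oplus>\<^bsub>X\<^esub> z) = c \<odot>\<^bsub>X\<^esub> y \<oplus>\<^bsub>X\<^esub> c \<odot>\<^bsub>X\<^esub> z"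
    "x \<in> carrier X"
  shows "c \<odot>\<^bsub>quot_algebra X J\<^esub> (J +>\<^bsub>X\<^esub> x) = J +>\<^bsub>X\<^esub> (c \<odot>\<^bsub>X\<^esub> x)"
proof -
  interpret J: ideal J X by fact
  have "J +>\<^bsub>X\<^esub> (c \<odot>\<^bsub>X\<^esub> y) = J +>\<^bsub>X\<^esub> (c \<odot>\<^bsub>X\<^esub> x)" if "y \<in> J +>\<^bsub>X\<^esub> x" for y
  proof -
    from that obtain j where j: "j \<in> J" "y = j \<oplus>\<^bsub>X\<^esub> x" by (auto simp: a_r_coset_def')
    then have "c \<odot>\<^bsub>X\<^esub> y = c \<odot>\<^bsub>X\<^esub> j \<oplus>\<^bsub>X\<^esub> c \<odot>\<^bsub>X\<^esub> x" using assms by simp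
    then have "c \<odot>\<^bsub>X\<^esub> y \<in> J +>\<^bsub>X\<^esub> (c \<odot>\<^bsub>X\<^esub> x)" using assms(3)[OF j(1)] by (auto simp: a_r_coset_def')
    then show ?thesis using J.a_repr_independence' assms(2,5) by metis
  qed
  moreover have "x \<in> J +>\<^bsub>X\<^esub> x" using J.a_rcos_self assms(5) by simp
  ultimately have "(\<Union>y\<in>J +>\<^bsub>X\<^esub> x. J +>\<^bsub>X\<^esub> (c \<odot>\<^bsub>X\<^esub> y)) = J +>\<^bsub>X\<^esub> (c \<odot>\<^bsub>X\<^esub> x)"
    by (intro UN_eq_const)
  then show ?thesis by (simp add: quot_algebra_simps)
qed

text \<open>The homomorphism theorem produces maps out of a quotient, whereas the isomorphisms
  wanted have the associated graded and the Rees algebra on the left. Each \<open>gX p\<close> lies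
  in the carrier, which lets \<open>inv_into\<close> undo the image of a graded piece.\<close>

lemma graded_isomorphic_sym:
  assumes "ring X" "\<phi> \<in> graded_iso X gX Y gY" "\<And>p. gX p \<subseteq> carrier X"
    "\<And>c x. x \<in> carrier X \<Longrightarrow> c \<odot>\<^bsub>X\<^esub> x \<in> carrier X"
  shows "graded_isomorphic Y gY X gX"
proof -
  let ?g = "inv_into (carrier X) \<phi>"
  have iso: "\<phi> \<in> ring_iso X Y" and sm: "\<And>c x. x \<in> carrier X \<Longrightarrow> \<phi> (c \<odot>\<^bsub>X\<^esub> x) = c \<odot>\<^bsub>Y\<^esub> \<phi> x"
    and gr: "\<And>p. \<phi> ` gX p = gY p"
    using assms(2) by (auto simp: graded_iso_def)
  have inj: "inj_on \<phi> (carrier X)" and im: "\<phi> ` carrier X = carrier Y"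
    using iso by (auto simp: ring_iso_def bij_betw_def)
  have "?g \<in> ring_iso Y X" using ring_iso_set_sym[OF assms(1) iso] .
  moreover have "?g (c \<odot>\<^bsub>Y\<^esub> y) = c \<odot>\<^bsub>X\<^esub> ?g y" if "y \<in> carrier Y" for c y
  proof -
    from that obtain x where "x \<in> carrier X" "y = \<phi> x" using im by blast
    then show ?thesis using inj assms(4) by (simp flip: sm)
  qed
  moreover have "?g ` gY p = gX p" for p
    using inv_into_image_cancel[OF inj assms(3)] by (simp flip: gr)
  ultimately have "?g \<in> graded_iso Y gY X gX" by (simp add: graded_iso_def)
  then show ?thesis by (auto simp: graded_isomorphic_def)
qed

text \<open>
  The target is not assumed to be a ring; this spares us the proof that the associated graded
  algebra and the Rees algebra satisfy the ring axioms.
\<close>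

locale ring_morphism = X?: ring X for X :: "('k, 'a) module" (structure) +
  fixes Y :: "('k, 'b) module" and h :: "'a \<Rightarrow> 'b"
  assumes hom: "h \<in> ring_hom X Y"
begin

lemma closed: "x \<in> carrier X \<Longrightarrow> h x \<in> carrier Y"
  and add: "x \<in> carrier X \<Longrightarrow> y \<in> carrier X \<Longrightarrow> h (x \<oplus> y) = h x \<oplus>\<^bsub>Y\<^esub> h y"
  and mult: "x \<in> carrier X \<Longrightarrow> y \<in> carrier X \<Longrightarrow> h (x \<otimes> y) = h x \<otimes>\<^bsub>Y\<^esub> h y"
  and one: "h \<one> = \<one>\<^bsub>Y\<^esub>"
  using hom by (auto simp: ring_hom_def)

text \<open>The comparison is with \<open>h \<zero>\<close> and not with the zero of
  \<open>Y\<close>: without group laws in \<open>Y\<close> it cannot be inferred that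
  \<open>h\<close> preserves zero.\<close>

definition kern :: "'a set" where
  "kern = {x \<in> carrier X. h x = h \<zero>}"

text \<open>This replaces cancellation in \<open>Y\<close>: equal values stay equal after adding a
  common summand in \<open>X\<close>, so every subtraction is carried out in
  \<open>X\<close>.\<close>

lemma h_add_cong:
  assumes "h a = h b" "a \<in> carrier X" "b \<in> carrier X" "c \<in> carrier X"
  shows "h (a \<oplus> c) = h (b \<oplus> c)"
  using assms add by simp

lemma kern_neg:
  assumes "a \<in> kern"
  shows "\<ominus> a \<in> kern"
  using h_add_cong[of a \<zero> "\<ominus> a"] assms by (simp add: kern_def r_neg)

lemma ideal_kern: "ideal kern X"
proof (rule idealI)
  show "subgroup kern (add_monoid X)"
  proof (rule subgroup.intro)
    fix x y assume "x \<in> kern" "y \<in> kern"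
    then show "x \<otimes>\<^bsub>add_monoid X\<^esub> y \<in> kern"
      using add[of x y] add[of \<zero> \<zero>] by (simp add: kern_def)
  next
    fix x assume "x \<in> kern"
    then show "inv\<^bsub>add_monoid X\<^esub> x \<in> kern"
      using kern_neg[of x] by (simp add: a_inv_def)
  qed (auto simp: kern_def)
next
  fix a x assume "a \<in> kern" "x \<in> carrier X"
  then show "x \<otimes> a \<in> kern" "a \<otimes> x \<in> kern"
    \<comment> \<open>The value at \<open>x \<otimes> a\<close> depends on \<open>a\<close> only
      through \<open>h a = h \<zero>\<close>, so it equals the value at
      \<open>x \<otimes> \<zero> = \<zero>\<close>. The instances at \<open>\<zero>\<close> stand in
      for zero laws in \<open>Y\<close>.\<close>
    using mult[of x a] mult[of a x] mult[of x \<zero>] mult[of \<zero> x] by (auto simp: kern_def)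
qed (rule ring_axioms)

lemma h_eq_iff:
  assumes "x \<in> carrier X" "y \<in> carrier X"
  shows "h x = h y \<longleftrightarrow> kern +> x = kern +> y"
proof -
  have "h x = h y \<longleftrightarrow> x \<ominus> y \<in> kern"
  proof
    assume "h x = h y"
    from h_add_cong[OF this, of "\<ominus> y"] show "x \<ominus> y \<in> kern"
      using assms by (simp add: kern_def a_minus_def r_neg)
  next
    assume "x \<ominus> y \<in> kern"
    then have "h (x \<ominus> y) = h \<zero>" by (simp add: kern_def)
    from h_add_cong[OF this, of y] show "h x = h y"
      using assms by (simp add: a_minus_def a_assoc l_neg)
  qed
  moreover have "kern +> x = kern +> y \<longleftrightarrow> x \<ominus> y \<in> kern"
    by (rule abelian_subgroup.a_rcos_eq_iff[OF _ assms])
      (rule abelian_subgroupI3[OF ideal.axioms(1)[OF ideal_kern] is_abelian_group])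
  ultimately show ?thesis by simp
qed

text \<open>Since \<open>h\<close> is constant on cosets of its kernel, the image of a coset is a
  singleton; this is the form in which \<open>natural_rho\<close> describes the induced map.\<close>

lemma the_elem_coset:
  assumes "x \<in> carrier X"
  shows "the_elem (h ` (kern +> x)) = h x"
proof -
  interpret K: ideal kern X by (rule ideal_kern)
  have "h y = h x" if "y \<in> kern +> x" for y
    using that assms h_eq_iff[of y x] K.a_repr_independence'[OF that] K.a_elemrcos_carrier[OF assms that]
    by simp
  then have "h ` (kern +> x) = {h x}" using K.a_rcos_self[OF assms] by blast
  then show ?thesis by simp
qed

text \<open>Well-definedness is read off from \<open>h\<close>: representatives have equal values,
  hence so do their scalar multiples, and the union over representatives collapses to one
  coset.\<close>

lemma smult_coset:
  assumes scl: "\<And>c x. x \<in> carrier X \<Longrightarrow> c \<odot> x \<in> carrier X"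
    and smul: "\<And>c x. x \<in> carrier X \<Longrightarrow> h (c \<odot> x) = c \<odot>\<^bsub>Y\<^esub> h x"
    and x: "x \<in> carrier X"
  shows "c \<odot>\<^bsub>quot_algebra X kern\<^esub> (kern +> x) = kern +> c \<odot> x"
proof -
  interpret K: ideal kern X by (rule ideal_kern)
  have "kern +> c \<odot> y = kern +> c \<odot> x" if "y \<in> kern +> x" for y
  proof -
    have y: "y \<in> carrier X" using that x K.a_elemrcos_carrier by simp
    have "h y = h x" using that x y h_eq_iff[of y x] K.a_repr_independence' by metis
    then have "h (c \<odot> y) = h (c \<odot> x)" using smul x y by simp
    then show ?thesis using h_eq_iff scl x y by blast
  qed
  moreover have "x \<in> kern +> x" using x K.a_rcos_self by simp
  ultimately have "(\<Union>y\<in>kern +> x. kern +> c \<odot> y) = kern +> c \<odot> x" by (intro UN_eq_const)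
  then show ?thesis by (simp add: quot_algebra_simps)
qed

text \<open>The first isomorphism theorem, with injectivity from \<open>h_eq_iff\<close>. The pieces
  of the quotient grading are the coset images of the \<open>gX p\<close>, so it suffices that
  \<open>h\<close> maps each \<open>gX p\<close> onto \<open>gY p\<close>.\<close>

lemma graded_iso_quot:
  assumes surj: "h ` carrier X = carrier Y"
    and scl: "\<And>c x. x \<in> carrier X \<Longrightarrow> c \<odot> x \<in> carrier X"
    and smul: "\<And>c x. x \<in> carrier X \<Longrightarrow> h (c \<odot> x) = c \<odot>\<^bsub>Y\<^esub> h x"
    and gX: "\<And>p. gX p \<subseteq> carrier X" and gY: "\<And>p. h ` gX p = gY p"
  shows "(\<lambda>C. the_elem (h ` C)) \<in> graded_iso (quot_algebra X kern) (quot_grading X kern gX) Y gY"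
proof -
  let ?A = "quot_algebra X kern" and ?f = "\<lambda>C. the_elem (h ` C)"
  have A: "carrier ?A = (\<lambda>x. kern +> x) ` carrier X" by (rule carrier_quot_algebra)
  have pi: "(\<lambda>x. kern +> x) \<in> ring_hom X ?A" by (rule ring_hom_quot_algebra) (rule ideal_kern)
  have "?f \<in> ring_hom ?A Y"
    by (rule ring_hom_memI)
      (auto simp: A the_elem_coset closed one mult add
        simp flip: ring_hom_one[OF pi] ring_hom_mult[OF pi] ring_hom_add[OF pi])
  moreover have "bij_betw ?f (carrier ?A) (carrier Y)"
    by (auto simp: bij_betw_def inj_on_def A the_elem_coset h_eq_iff image_image simp flip: surj)
  moreover have "?f (c \<odot>\<^bsub>?A\<^esub> C) = c \<odot>\<^bsub>Y\<^esub> ?f C" if C: "C \<in> carrier ?A" for c C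
    using C smult_coset[OF scl smul] scl smul by (auto simp: A the_elem_coset)
  moreover have "?f ` quot_grading X kern gX p = gY p" for p
  proof -
    have "?f ` quot_grading X kern gX p = h ` gX p"
      using gX[of p] the_elem_coset by (auto simp: quot_grading_def image_image intro!: image_cong)
    then show ?thesis using gY by simp
  qed
  ultimately show ?thesis by (simp add: graded_iso_def ring_iso_def)
qed

lemma graded_isomorphic_quot:
  assumes surj: "h ` carrier X = carrier Y"
    and scl: "\<And>c x. x \<in> carrier X \<Longrightarrow> c \<odot> x \<in> carrier X"
    and smul: "\<And>c x. x \<in> carrier X \<Longrightarrow> h (c \<odot> x) = c \<odot>\<^bsub>Y\<^esub> h x"
    and gX: "\<And>p. gX p \<subseteq> carrier X" and gY: "\<And>p. h ` gX p = gY p"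
  shows "graded_isomorphic Y gY (quot_algebra X kern) (quot_grading X kern gX)"
proof (rule graded_isomorphic_sym[OF ring_quot_algebra[OF ideal_kern] graded_iso_quot[OF assms]])
  show "quot_grading X kern gX p \<subseteq> carrier (quot_algebra X kern)" for p
    using gX[of p] by (auto simp: quot_grading_def carrier_quot_algebra)
  show "c \<odot>\<^bsub>quot_algebra X kern\<^esub> C \<in> carrier (quot_algebra X kern)" if "C \<in> carrier (quot_algebra X kern)" for c C
    using that smult_coset[OF scl smul] scl by (auto simp: carrier_quot_algebra)
qed

end

section \<open>Associated graded algebra of a filtered ring, computed on representatives\<close>

locale filtered_ring = ring A for A :: "('k, 'a) module" (structure) +
  fixes F :: "nat \<Rightarrow> 'a set"
  assumes F_subgroup: "additive_subgroup (F p) A"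
    and F_mono: "F p \<subseteq> F (Suc p)"
    and F_mult: "x \<in> F p \<Longrightarrow> y \<in> F q \<Longrightarrow> x \<otimes> y \<in> F (p + q)"
begin

abbreviation N :: "nat \<Rightarrow> 'a set" where "N \<equiv> filt_pred A F"

abbreviation cls :: "(nat \<Rightarrow> 'a) \<Rightarrow> nat \<Rightarrow> 'a set" where "cls a \<equiv> (\<lambda>p. N p +> a p)"

lemma N_subgroup: "abelian_subgroup (N p) A"
proof (rule abelian_subgroupI3)
  have "additive_subgroup {\<zero>} A" using zeroideal by (simp add: ideal_def)
  then show "additive_subgroup (N p) A" using F_subgroup by (simp add: filt_pred_def)
qed (rule is_abelian_group)

lemma F_carrier: "x \<in> F p \<Longrightarrow> x \<in> carrier A"
  using additive_subgroup.a_Hcarr[OF F_subgroup] by blast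

lemma N_carrier: "x \<in> N p \<Longrightarrow> x \<in> carrier A"
  using F_carrier by (auto simp: filt_pred_def split: if_splits)

lemma F_zero: "\<zero> \<in> F p"
  using additive_subgroup.zero_closed[OF F_subgroup] .

lemma N_subset_F: "N p \<subseteq> F p"
  using F_mono[of "p - 1"] F_zero by (auto simp: filt_pred_def)

text \<open>For \<open>p > 0\<close> this is \<open>F (p - 1)\<close> times \<open>F q\<close>
  landing in \<open>F (p + q - 1)\<close>. For \<open>p = 0\<close> the only element of
  \<open>N 0\<close> is zero, and the product is zero, which lies in every \<open>N\<close>.\<close>

lemma N_mult:
  assumes "x \<in> N p" "y \<in> F q"
  shows "x \<otimes> y \<in> N (p + q)" "y \<otimes> x \<in> N (p + q)"
proof -
  note z = additive_subgroup.zero_closed[OF abelian_subgroup.axioms(1)[OF N_subgroup]]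
  show "x \<otimes> y \<in> N (p + q)" "y \<otimes> x \<in> N (p + q)"
    using assms z[of "p + q"] F_carrier[of y q] F_mult[of x "p - 1" y q] F_mult[of y q x "p - 1"]
    by (auto simp: filt_pred_def add.commute split: if_splits)
qed

lemma coset_finsum_cong:
  assumes "finite S" "\<And>i. i \<in> S \<Longrightarrow> f i \<in> carrier A" "\<And>i. i \<in> S \<Longrightarrow> g i \<in> carrier A"
    "\<And>i. i \<in> S \<Longrightarrow> N p +> f i = N p +> g i"
  shows "N p +> (\<Oplus>i\<in>S. f i) = N p +> (\<Oplus>i\<in>S. g i)"
  using assms
proof (induction S rule: finite_induct)
  case (insert i S)
  interpret Np: abelian_subgroup "N p" A by (rule N_subgroup)
  have "N p +> (f i \<oplus> finsum A f S) = N p +> (g i \<oplus> finsum A g S)"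
    using insert by (simp flip: Np.a_rcos_sum add: finsum_closed Pi_def)
  then show ?case using insert by (simp add: finsum_insert Pi_def)
qed simp

lemma coset_rep:
  assumes "x \<in> N p +> a" "a \<in> F p"
  obtains n where "n \<in> N p" "x = n \<oplus> a" "x \<in> F p"
proof -
  from assms obtain n where n: "n \<in> N p" "x = n \<oplus> a" by (auto simp: a_r_coset_def')
  moreover have "x \<in> F p"
    using n assms(2) N_subset_F additive_subgroup.a_closed[OF F_subgroup] by blast
  ultimately show thesis using that by blast
qed

lemma coset_mult_cong:
  assumes "a \<in> F p" "b \<in> F q" "x \<in> N p +> a" "y \<in> N q +> b"
  shows "N (p + q) +> (x \<otimes> y) = N (p + q) +> (a \<otimes> b)"
proof -
  interpret Np: abelian_subgroup "N (p + q)" A by (rule N_subgroup)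
  from assms obtain m n where m: "m \<in> N p" "x = m \<oplus> a" "x \<in> F p" and n: "n \<in> N q" "y = n \<oplus> b" "y \<in> F q"
    by (metis coset_rep)
  note c = F_carrier[OF assms(1)] F_carrier[OF assms(2)] N_carrier[OF m(1)] N_carrier[OF n(1)]
  \<comment> \<open>Keeping \<open>y = n \<oplus> b\<close> unexpanded next to \<open>m\<close>
    leaves just two terms, each with one factor in a smaller filtration step.\<close>
  have "x \<otimes> y \<ominus> a \<otimes> b = m \<otimes> y \<oplus> a \<otimes> n"
    unfolding m(2) n(2) using c by algebra
  also have "\<dots> \<in> N (p + q)"
    using N_mult(1)[OF m(1) n(3)] N_mult(2)[OF n(1) assms(1)]
    by (simp add: add.commute)
  finally show ?thesis using Np.a_rcos_eq_iff c m n F_carrier by simp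
qed

lemma cls_self: "(\<And>p. a p \<in> F p) \<Longrightarrow> a \<in> Pi UNIV (cls a)"
  using abelian_subgroup.a_rcos_self[OF N_subgroup] F_carrier by blast

text \<open>The product is a union over all choices of representatives in all degrees at once. Every
  choice gives the same coset, and \<open>a\<close> and \<open>b\<close> are themselves admissible
  choices, so the union is exactly this coset.\<close>

lemma mult_cls:
  assumes a: "\<And>p. a p \<in> F p" and b: "\<And>p. b p \<in> F p"
  shows "cls a \<otimes>\<^bsub>assoc_graded A F\<^esub> cls b = cls (\<lambda>p. \<Oplus>i\<in>{..p}. a i \<otimes> b (p - i))"
proof
  fix p
  have "N p +> (\<Oplus>i\<in>{..p}. x i \<otimes> y (p - i)) = N p +> (\<Oplus>i\<in>{..p}. a i \<otimes> b (p - i))"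
    if x: "x \<in> Pi UNIV (cls a)" and y: "y \<in> Pi UNIV (cls b)" for x y
  proof (rule coset_finsum_cong)
    have xy: "x i \<in> carrier A" "y i \<in> carrier A" for i
      using x y a b F_carrier
      by (metis (no_types, lifting) Pi_mem UNIV_I coset_rep)+
    fix i assume i: "i \<in> {..p}"
    show "x i \<otimes> y (p - i) \<in> carrier A" "a i \<otimes> b (p - i) \<in> carrier A"
      using xy a b F_carrier by blast+
    show "N p +> x i \<otimes> y (p - i) = N p +> a i \<otimes> b (p - i)"
      using coset_mult_cong[OF a[of i] b[of "p - i"], of "x i" "y (p - i)"] x y i
      by (auto simp: Pi_def)
  qed simp
  note same = this
  have "(cls a \<otimes>\<^bsub>assoc_graded A F\<^esub> cls b) p =
      (\<Union>x\<in>Pi UNIV (cls a). \<Union>y\<in>Pi UNIV (cls b). N p +> (\<Oplus>i\<in>{..p}. x i \<otimes> y (p - i)))"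
    by (simp add: assoc_graded_def)
  also have "\<dots> = N p +> (\<Oplus>i\<in>{..p}. a i \<otimes> b (p - i))"
    using a b by (intro UN_eq_const[OF cls_self] UN_eq_const[OF cls_self] same) auto
  finally show "(cls a \<otimes>\<^bsub>assoc_graded A F\<^esub> cls b) p = N p +> (\<Oplus>i\<in>{..p}. a i \<otimes> b (p - i))" .
qed

lemma add_cls:
  assumes a: "\<And>p. a p \<in> F p" and b: "\<And>p. b p \<in> F p"
  shows "cls a \<oplus>\<^bsub>assoc_graded A F\<^esub> cls b = cls (\<lambda>p. a p \<oplus> b p)"
proof
  fix p
  show "(cls a \<oplus>\<^bsub>assoc_graded A F\<^esub> cls b) p = N p +> (a p \<oplus> b p)"
    using abelian_subgroup.a_rcos_sum[OF N_subgroup F_carrier[OF a] F_carrier[OF b]]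
    by (simp add: assoc_graded_def)
qed

text \<open>The assumption \<open>c \<odot> \<zero> = \<zero>\<close> serves degree 0, where
  \<open>N 0\<close> is the zero set and not a filtration step; in positive degrees
  \<open>N p\<close> is \<open>F (p - 1)\<close> and is preserved by the first part of
  \<open>s\<close>.\<close>

lemma smult_cls:
  assumes a: "\<And>p. a p \<in> F p" and s: "\<And>p x. x \<in> F p \<Longrightarrow> c \<odot> x \<in> F p" "c \<odot> \<zero> = \<zero>"
    and add: "\<And>x y. x \<in> carrier A \<Longrightarrow> y \<in> carrier A \<Longrightarrow> c \<odot> (x \<oplus> y) = c \<odot> x \<oplus> c \<odot> y"
  shows "c \<odot>\<^bsub>assoc_graded A F\<^esub> cls a = cls (\<lambda>p. c \<odot> a p)"
proof
  fix p
  interpret Np: abelian_subgroup "N p" A by (rule N_subgroup)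
  have "N p +> c \<odot> x = N p +> c \<odot> a p" if "x \<in> N p +> a p" for x
  proof -
    from that obtain n where n: "n \<in> N p" "x = n \<oplus> a p" using coset_rep a by metis
    have "c \<odot> n \<in> N p" using n(1) s by (auto simp: filt_pred_def split: if_splits)
    moreover have "c \<odot> x = c \<odot> n \<oplus> c \<odot> a p" using n a F_carrier N_carrier add by blast
    ultimately have "c \<odot> x \<in> N p +> c \<odot> a p" by (auto simp: a_r_coset_def')
    then show ?thesis using Np.a_repr_independence' F_carrier[OF s(1)[OF a]] by metis
  qed
  moreover have "a p \<in> N p +> a p" using Np.a_rcos_self F_carrier a by blast
  ultimately have "(\<Union>x\<in>N p +> a p. N p +> c \<odot> x) = N p +> c \<odot> a p"
    by (intro UN_eq_const)
  then show "(c \<odot>\<^bsub>assoc_graded A F\<^esub> cls a) p = N p +> c \<odot> a p"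
    by (simp add: assoc_graded_def)
qed

end

section \<open>Homogeneous components in the path algebra\<close>

text \<open>Having \<open>R\<close> as a parameter with an equation makes it the implicit structure
  of the ring notation.\<close>

locale path_ring =
  fixes Q :: "('v, 'e) pre_digraph" and R :: "('k::field, ('v, 'e) path \<Rightarrow>\<^sub>0 'k) module" (structure)
  assumes fin: "fin_digraph Q" and R_eq: "R = path_algebra Q"

sublocale path_ring \<subseteq> ring R
  using ring_path_algebra[OF fin] by (simp add: R_eq)

lemma path_length_concat: "path_length (path_concat u v) = path_length u + path_length v"
  by (simp add: path_length_def path_concat_def)

lemma lookup_hcomp:
  "Poly_Mapping.lookup (hcomp p f) u = (if path_length u = p then Poly_Mapping.lookup f u else 0)"
proof -
  have "Poly_Mapping.lookup (hcomp p f) u =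
      (\<Sum>v\<in>{v \<in> Poly_Mapping.keys f. path_length v = p}. if v = u then Poly_Mapping.lookup f v else 0)"
    unfolding hcomp_def by (auto simp: lookup_sum lookup_single when_def intro!: sum.cong)
  then show ?thesis by (simp add: in_keys_iff)
qed

lemma keys_hcomp: "Poly_Mapping.keys (hcomp p f) = {u \<in> Poly_Mapping.keys f. path_length u = p}"
  by (auto simp: in_keys_iff lookup_hcomp split: if_splits)

lemma hcomp_add: "hcomp p (f + g) = hcomp p f + hcomp p g"
  by (rule poly_mapping_eqI) (simp add: lookup_hcomp lookup_add)

lemma hcomp_zero: "hcomp p 0 = 0"
  by (rule poly_mapping_eqI) (simp add: lookup_hcomp)

lemma hcomp_minus: "hcomp p (f - g) = hcomp p f - hcomp p g"
  by (rule poly_mapping_eqI) (simp add: lookup_hcomp lookup_minus)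

lemma hcomp_sum: "hcomp p (\<Sum>x\<in>X. f x) = (\<Sum>x\<in>X. hcomp p (f x))"
  by (induction X rule: infinite_finite_induct) (simp_all add: hcomp_add hcomp_zero)

lemma hcomp_hcomp: "hcomp p (hcomp q f) = (if p = q then hcomp p f else 0)"
  by (rule poly_mapping_eqI) (simp add: lookup_hcomp)

lemma hcomp_single: "hcomp p (Poly_Mapping.single u a) = (if path_length u = p then Poly_Mapping.single u a else 0)"
  by (rule poly_mapping_eqI) (simp add: lookup_hcomp lookup_single when_def)

lemma hcomp_eq_0: "(\<And>u. u \<in> Poly_Mapping.keys f \<Longrightarrow> path_length u \<noteq> p) \<Longrightarrow> hcomp p f = 0"
  by (rule poly_mapping_eqI) (auto simp: lookup_hcomp in_keys_iff)

lemma sum_hcomp: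
  assumes "\<And>u. u \<in> Poly_Mapping.keys f \<Longrightarrow> path_length u \<in> P" "finite P"
  shows "(\<Sum>p\<in>P. hcomp p f) = f"
proof (rule poly_mapping_eqI)
  fix u
  show "Poly_Mapping.lookup (\<Sum>p\<in>P. hcomp p f) u = Poly_Mapping.lookup f u"
    using assms by (cases "u \<in> Poly_Mapping.keys f") (simp_all add: lookup_sum lookup_hcomp in_keys_iff)
qed

lemma path_length_le_pdeg: "u \<in> Poly_Mapping.keys f \<Longrightarrow> path_length u \<le> pdeg f"
  by (simp add: pdeg_def)

lemma pdeg_le: "f \<noteq> 0 \<Longrightarrow> (\<And>u. u \<in> Poly_Mapping.keys f \<Longrightarrow> path_length u \<le> p) \<Longrightarrow> pdeg f \<le> p"
  by (simp add: pdeg_def)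

context path_ring
begin

lemma carrier_iff: "f \<in> carrier R \<longleftrightarrow> Poly_Mapping.keys f \<subseteq> paths Q"
  by (simp add: R_eq path_algebra_def)

lemma zero_eq: "\<zero> = 0"
  by (simp add: R_eq path_algebra_def)

lemma add_eq: "f \<oplus> g = f + g"
  by (simp add: R_eq path_algebra_def)

text \<open>Inside the carrier only: the inverse of the record is a description over carrier
  elements, so it has to be identified through \<open>r_neg\<close>.\<close>

lemma uminus_eq: "f \<in> carrier R \<Longrightarrow> \<ominus> f = - f"
  using r_neg[of f] by (simp add: add_eq zero_eq add_eq_0_iff)

lemma minus_eq: "g \<in> carrier R \<Longrightarrow> f \<ominus> g = f - g"
  by (simp add: a_minus_def uminus_eq add_eq)

lemma finsum_eq_sum: "finite S \<Longrightarrow> (\<And>i. i \<in> S \<Longrightarrow> f i \<in> carrier R) \<Longrightarrow> finsum R f S = sum f S"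
  by (induction S rule: finite_induct) (simp_all add: zero_eq add_eq Pi_def)

lemma sum_closed: "(\<And>i. i \<in> S \<Longrightarrow> f i \<in> carrier R) \<Longrightarrow> sum f S \<in> carrier R"
  unfolding carrier_iff by (rule keys_sum_subset)

lemma minus_closed_class: "f \<in> carrier R \<Longrightarrow> g \<in> carrier R \<Longrightarrow> f - g \<in> carrier R"
  using minus_closed[of f g] by (simp add: minus_eq)

lemma single_closed: "u \<in> paths Q \<Longrightarrow> Poly_Mapping.single u a \<in> carrier R"
  by (simp add: carrier_iff)

lemma hcomp_closed: "f \<in> carrier R \<Longrightarrow> hcomp p f \<in> carrier R"
  by (auto simp: carrier_iff keys_hcomp)

lemma mult_single: "Poly_Mapping.single u a \<otimes> Poly_Mapping.single v b = path_mult_term Q u v (a * b)"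
  unfolding R_eq by (rule mult_path_algebra_single)

lemma mult_zero: "0 \<otimes> g = 0" "g \<otimes> 0 = 0"
  unfolding R_eq by (rule mult_path_algebra_zero)+

lemma mult_distr: "(f + f') \<otimes> g = f \<otimes> g + f' \<otimes> g" "g \<otimes> (f + f') = g \<otimes> f + g \<otimes> f'"
  unfolding R_eq by (rule mult_path_algebra_distr)+

lemma mult_sum: "(\<Sum>x\<in>X. f x) \<otimes> g = (\<Sum>x\<in>X. f x \<otimes> g)" "g \<otimes> (\<Sum>x\<in>X. f x) = (\<Sum>x\<in>X. g \<otimes> f x)"
  unfolding R_eq by (rule mult_path_algebra_sum)+

text \<open>Induction for biadditive statements: whatever survives sums in either argument need only
  be checked on scalar multiples of two paths.\<close>

lemma mult_induct2:
  fixes f g :: "('v, 'e) path \<Rightarrow>\<^sub>0 'k"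
  assumes "\<And>f f' g. P f g \<Longrightarrow> P f' g \<Longrightarrow> P (f + f') g" "\<And>f g g'. P f g \<Longrightarrow> P f g' \<Longrightarrow> P f (g + g')"
    and "\<And>g. P 0 g" "\<And>f. P f 0"
    and "\<And>u v a b. P (Poly_Mapping.single u a) (Poly_Mapping.single v b)"
  shows "P f g"
proof -
  have sumR: "P f (\<Sum>x\<in>X. g x)" if "\<And>x. x \<in> X \<Longrightarrow> P f (g x)" for f and g :: "('v, 'e) path \<Rightarrow> ('v, 'e) path \<Rightarrow>\<^sub>0 'k" and X
    using that by (induction X rule: infinite_finite_induct) (simp_all add: assms)
  have sumL: "P (\<Sum>x\<in>X. f x) g" if "\<And>x. x \<in> X \<Longrightarrow> P (f x) g" for g and f :: "('v, 'e) path \<Rightarrow> ('v, 'e) path \<Rightarrow>\<^sub>0 'k" and X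
    using that by (induction X rule: infinite_finite_induct) (simp_all add: assms)
  have "P (\<Sum>u\<in>Poly_Mapping.keys f. Poly_Mapping.single u (Poly_Mapping.lookup f u))
      (\<Sum>u\<in>Poly_Mapping.keys g. Poly_Mapping.single u (Poly_Mapping.lookup g u))"
    by (intro sumL sumR assms)
  then show ?thesis by (simp flip: path_sum_singles)
qed

lemma hcomp_mult: "hcomp p (f \<otimes> g) = (\<Sum>i\<le>p. hcomp i f \<otimes> hcomp (p - i) g)"
proof (induction f g rule: mult_induct2)
  case (5 u v a b)
  have "(\<Sum>i\<le>p. hcomp i (Poly_Mapping.single u a) \<otimes> hcomp (p - i) (Poly_Mapping.single v b)) =
      (\<Sum>i\<le>p. if i = path_length u \<and> path_length u + path_length v = p then path_mult_term Q u v (a * b) else 0)"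
    by (intro sum.cong) (auto simp: hcomp_single mult_single mult_zero)
  also have "\<dots> = (if path_length u + path_length v = p then path_mult_term Q u v (a * b) else 0)"
    by auto
  finally show ?case
    by (auto simp: mult_single path_mult_term_def hcomp_single path_length_concat hcomp_zero)
qed (simp_all add: mult_distr hcomp_add hcomp_zero mult_zero sum.distrib)

lemma hcomp_one: "hcomp p \<one> = (if p = 0 then \<one> else 0)"
proof -
  have "\<one> = (\<Sum>v\<in>verts Q. Poly_Mapping.single (v, []) 1)" by (simp add: R_eq path_algebra_def)
  then show ?thesis by (simp add: hcomp_sum hcomp_single path_length_def)
qed

lemma lookup_smult: "Poly_Mapping.lookup (c \<odot> f) u = c * Poly_Mapping.lookup f u"
  by (simp add: R_eq path_algebra_def Poly_Mapping.map.rep_eq when_def)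

lemma smult_closed: "f \<in> carrier R \<Longrightarrow> c \<odot> f \<in> carrier R"
  by (auto simp: carrier_iff in_keys_iff lookup_smult)

lemma smult_add: "c \<odot> (f + g) = c \<odot> f + c \<odot> g"
  by (rule poly_mapping_eqI) (simp add: lookup_smult lookup_add distrib_left)

lemma smult_zero: "c \<odot> 0 = 0"
  by (rule poly_mapping_eqI) (simp add: lookup_smult)

lemma smult_sum: "c \<odot> (\<Sum>x\<in>X. f x) = (\<Sum>x\<in>X. c \<odot> f x)"
  by (induction X rule: infinite_finite_induct) (simp_all add: smult_add smult_zero)

lemma smult_single: "c \<odot> Poly_Mapping.single u a = Poly_Mapping.single u (c * a)"
  by (rule poly_mapping_eqI) (simp add: lookup_smult lookup_single when_def)

lemma hcomp_smult: "hcomp p (c \<odot> f) = c \<odot> hcomp p f"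
  by (rule poly_mapping_eqI) (simp add: lookup_hcomp lookup_smult)

lemma smult_mult: "c \<odot> (f \<otimes> g) = (c \<odot> f) \<otimes> g"
proof (induction f g rule: mult_induct2)
  case (5 u v a b)
  then show ?case by (simp add: mult_single smult_single path_mult_term_def smult_zero mult.assoc)
qed (simp_all add: mult_distr smult_add smult_zero mult_zero)

text \<open>Scalars act as left multiplication by multiples of the unit; this is why two-sided
  ideals are automatically closed under scalars.\<close>

lemma smult_conv_mult: "f \<in> carrier R \<Longrightarrow> c \<odot> f = (c \<odot> \<one>) \<otimes> f"
  by (simp flip: smult_mult)

lemma smult_ideal: "ideal J R \<Longrightarrow> f \<in> J \<Longrightarrow> c \<odot> f \<in> J"
  using smult_conv_mult[of f c] ideal.I_l_closed[of J R f "c \<odot> \<one>"] smult_closed[of \<one> c] ideal.Icarr[of J R f]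
  by simp

lemma trivial_path: "u \<in> paths Q \<Longrightarrow> (fst u, []) \<in> paths Q \<and> (path_target Q u, []) \<in> paths Q"
proof -
  interpret fin_digraph Q by (rule fin)
  assume "u \<in> paths Q"
  then obtain v where "awalk (fst u) (snd u) v" by (auto simp: paths_def)
  then have "fst u \<in> verts Q" "path_target Q u \<in> verts Q"
    by (auto simp: awalk_def path_target_alt head_in_verts subset_iff)
  then show ?thesis by (auto simp: paths_def awalk_def cas.simps)
qed

lemma mult_keys:
  "u \<in> Poly_Mapping.keys (f \<otimes> g) \<Longrightarrow>
    \<exists>v\<in>Poly_Mapping.keys f. \<exists>w\<in>Poly_Mapping.keys g. composable Q v w \<and> u = path_concat v w"
proof -
  assume u: "u \<in> Poly_Mapping.keys (f \<otimes> g)"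
  have "Poly_Mapping.keys (f \<otimes> g) \<subseteq>
      {path_concat v w | v w. v \<in> Poly_Mapping.keys f \<and> w \<in> Poly_Mapping.keys g \<and> composable Q v w}"
    unfolding R_eq mult_path_algebra_superset[OF finite_keys finite_keys subset_refl subset_refl]
    by (intro keys_sum_subset) (auto simp: path_mult_term_def)
  with u show ?thesis by blast
qed

end

section \<open>Reduction modulo a Groebner basis\<close>

lemma path_target_concat: "composable Q u v \<Longrightarrow> path_target Q (path_concat u v) = path_target Q v"
  by (auto simp: path_target_alt path_concat_def composable_def path_source_def)

lemma composable_concat_right: "composable Q u (path_concat v w) \<longleftrightarrow> composable Q u v"
  by (simp add: composable_def path_source_def path_concat_def)

lemma composable_concat_left: "composable Q u v \<Longrightarrow> composable Q (path_concat u v) w \<longleftrightarrow> composable Q v w"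
  by (simp add: composable_def path_target_concat)

lemma path_concat_assoc: "path_concat (path_concat u v) w = path_concat u (path_concat v w)"
  by (simp add: path_concat_def)

text \<open>The arc lists cancel on both sides, and the start vertices agree because both equal the
  target of \<open>w\<close>.\<close>

lemma path_concat_inj:
  assumes "composable Q w v" "composable Q w v'" "path_concat (path_concat w v) s = path_concat (path_concat w v') s"
  shows "v = v'"
  using assms by (auto simp: path_concat_def composable_def path_source_def prod_eq_iff)

lemma trivial_path_concat:
  "composable Q (fst u, []) u" "path_concat (fst u, []) u = u"
  "composable Q u (path_target Q u, [])" "path_concat u (path_target Q u, []) = u"
  by (simp_all add: composable_def path_target_alt path_source_def path_concat_def)

context path_ring
begin

text \<open>Only nonzero products \<open>w m s\<close> count, hence the composability conditions.
  Taking trivial paths for \<open>w\<close> and \<open>s\<close> shows that every path in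
  \<open>M\<close> is a multiple of itself.\<close>

definition monomial_multiples :: "('v, 'e) path set \<Rightarrow> ('v, 'e) path set" where
  "monomial_multiples M = {path_concat (path_concat w m) s | w m s. m \<in> M \<and> w \<in> paths Q \<and> s \<in> paths Q \<and>
      composable Q w m \<and> composable Q (path_concat w m) s}"

lemma monomial_multiplesI:
  "m \<in> M \<Longrightarrow> w \<in> paths Q \<Longrightarrow> s \<in> paths Q \<Longrightarrow> composable Q w m \<Longrightarrow> composable Q (path_concat w m) s \<Longrightarrow>
    u = path_concat (path_concat w m) s \<Longrightarrow> u \<in> monomial_multiples M"
  unfolding monomial_multiples_def by blast

lemma monomial_multiplesE:
  assumes "u \<in> monomial_multiples M"
  obtains w m s where "u = path_concat (path_concat w m) s" "m \<in> M" "w \<in> paths Q"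
    "s \<in> paths Q" "composable Q w m" "composable Q (path_concat w m) s"
  using assms unfolding monomial_multiples_def by blast

lemma monomial_multiples_concat:
  assumes "u \<in> monomial_multiples M" "v \<in> paths Q"
  shows "composable Q v u \<Longrightarrow> path_concat v u \<in> monomial_multiples M"
    and "composable Q u v \<Longrightarrow> path_concat u v \<in> monomial_multiples M"
proof -
  from assms(1) obtain w m s where u: "u = path_concat (path_concat w m) s" "m \<in> M" "w \<in> paths Q"
    "s \<in> paths Q" "composable Q w m" "composable Q (path_concat w m) s"
    by (rule monomial_multiplesE)
  then have ms: "composable Q m s" by (simp add: composable_concat_left)
  show "path_concat v u \<in> monomial_multiples M" if "composable Q v u"
  proof -
    have "composable Q v w" using that u by (simp add: composable_concat_right)
    then have "path_concat v w \<in> paths Q" "composable Q (path_concat v w) m"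
      "composable Q (path_concat (path_concat v w) m) s"
      using u assms(2) ms by (simp_all add: path_concat_in_paths composable_concat_left)
    then show ?thesis
      using u by (intro monomial_multiplesI[of m M "path_concat v w" s]) (simp_all add: path_concat_assoc)
  qed
  show "path_concat u v \<in> monomial_multiples M" if "composable Q u v"
  proof -
    have "composable Q s v" using that u by (simp add: composable_concat_left)
    then have "path_concat s v \<in> paths Q" "composable Q (path_concat w m) (path_concat s v)"
      using u assms(2) by (simp_all add: path_concat_in_paths composable_concat_right)
    then show ?thesis
      using u by (intro monomial_multiplesI[of m M w "path_concat s v"]) (simp_all add: path_concat_assoc)
  qed
qed

text \<open>Multiplying by a further path either gives zero or enlarges \<open>w\<close> or
  \<open>s\<close>. The ideal therefore describes what the paths in \<open>M\<close> generate by its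
  paths alone, which turns ideal membership of a path into divisibility.\<close>

lemma ideal_monomial_multiples:
  "ideal {x \<in> carrier R. Poly_Mapping.keys x \<subseteq> monomial_multiples M} R" (is "ideal ?J R")
proof (rule idealI)
  show "subgroup ?J (add_monoid R)"
  proof (rule subgroup.intro)
    fix x y assume "x \<in> ?J" "y \<in> ?J"
    then show "x \<otimes>\<^bsub>add_monoid R\<^esub> y \<in> ?J"
      using Poly_Mapping.keys_add[of x y] a_closed[of x y] by (auto simp: add_eq)
  next
    fix x assume "x \<in> ?J"
    then show "inv\<^bsub>add_monoid R\<^esub> x \<in> ?J"
      using a_inv_closed[of x] by (auto simp: uminus_eq simp flip: a_inv_def)
  qed (auto simp: zero_eq carrier_iff)
next
  fix a x assume a: "a \<in> ?J" and x: "x \<in> carrier R"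
  show "x \<otimes> a \<in> ?J"
  proof (intro CollectI conjI subsetI)
    fix u assume "u \<in> Poly_Mapping.keys (x \<otimes> a)"
    then show "u \<in> monomial_multiples M"
      using mult_keys[of u x a] a x monomial_multiples_concat(1)
      unfolding carrier_iff by blast
  qed (use a x in simp)
  show "a \<otimes> x \<in> ?J"
  proof (intro CollectI conjI subsetI)
    fix u assume "u \<in> Poly_Mapping.keys (a \<otimes> x)"
    then show "u \<in> monomial_multiples M"
      using mult_keys[of u a x] a x monomial_multiples_concat(2)
      unfolding carrier_iff by blast
  qed (use a x in simp)
qed (rule ring_axioms)

lemma keys_sandwich:
  assumes "u \<in> Poly_Mapping.keys (Poly_Mapping.single w c \<otimes> g \<otimes> Poly_Mapping.single s 1)"
  obtains v where "v \<in> Poly_Mapping.keys g" "composable Q w v" "composable Q (path_concat w v) s"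
    "u = path_concat (path_concat w v) s"
proof -
  from mult_keys[OF assms] obtain x where x: "x \<in> Poly_Mapping.keys (Poly_Mapping.single w c \<otimes> g)"
    "composable Q x s" "u = path_concat x s" by (auto split: if_splits)
  from mult_keys[OF x(1)] obtain v where "v \<in> Poly_Mapping.keys g" "composable Q w v" "x = path_concat w v"
    by (auto split: if_splits)
  with x that show thesis by blast
qed

text \<open>Distinct paths \<open>v\<close> give distinct products \<open>w v s\<close>, so no other
  term of \<open>g\<close> can contribute to this coefficient; \<open>g'\<close> collects these
  other terms.\<close>

lemma lookup_sandwich:
  assumes "composable Q w v" "composable Q (path_concat w v) s"
  shows "Poly_Mapping.lookup (Poly_Mapping.single w c \<otimes> g \<otimes> Poly_Mapping.single s 1)
    (path_concat (path_concat w v) s) = c * Poly_Mapping.lookup g v"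
proof -
  define g' where "g' = g - Poly_Mapping.single v (Poly_Mapping.lookup g v)"
  let ?u = "path_concat (path_concat w v) s"
  have g: "g = Poly_Mapping.single v (Poly_Mapping.lookup g v) + g'" by (simp add: g'_def)
  have "v \<notin> Poly_Mapping.keys g'" by (simp add: g'_def in_keys_iff lookup_minus)
  then have "?u \<notin> Poly_Mapping.keys (Poly_Mapping.single w c \<otimes> g' \<otimes> Poly_Mapping.single s 1)"
    using assms path_concat_inj by (metis keys_sandwich)
  then show ?thesis
    using assms by (subst g, unfold mult_distr)
      (simp add: mult_single path_mult_term_def lookup_add in_keys_iff)
qed

end

section \<open>Leading monomials for a graded ordering\<close>

locale monomial_ordering = path_ring Q R
  for Q :: "('v, 'e) pre_digraph" and R :: "('k::field, ('v, 'e) path \<Rightarrow>\<^sub>0 'k) module" (structure) +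
  fixes r :: "('v, 'e) path rel"
  assumes ord: "graded_monomial_ordering Q r"
begin

lemma order_facts:
  "refl_on (paths Q) r" "trans r" "antisym r" "total_on (paths Q) r" "wf (r - Id)"
proof -
  have "well_order_on (paths Q) r" using ord unfolding graded_monomial_ordering_def by blast
  then show "refl_on (paths Q) r" "trans r" "antisym r" "total_on (paths Q) r" "wf (r - Id)"
    by (simp_all add: well_order_on_def linear_order_on_def partial_order_on_def preorder_on_def)
qed

lemma order_mult:
  "(v, u) \<in> r \<Longrightarrow> v \<noteq> u \<Longrightarrow> u \<in> paths Q \<Longrightarrow> v \<in> paths Q \<Longrightarrow> w \<in> paths Q \<Longrightarrow> s \<in> paths Q \<Longrightarrow>
    composable Q w u \<Longrightarrow> composable Q (path_concat w u) s \<Longrightarrow>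
    composable Q w v \<Longrightarrow> composable Q (path_concat w v) s \<Longrightarrow>
    (path_concat (path_concat w v) s, path_concat (path_concat w u) s) \<in> r"
  using ord unfolding graded_monomial_ordering_def by blast

lemma order_graded:
  "u \<in> paths Q \<Longrightarrow> v \<in> paths Q \<Longrightarrow> path_length v < path_length u \<Longrightarrow> (v, u) \<in> r"
  using ord unfolding graded_monomial_ordering_def by blast

lemma finite_max:
  assumes "finite S" "S \<noteq> {}" "S \<subseteq> paths Q"
  shows "\<exists>u\<in>S. \<forall>v\<in>S. (v, u) \<in> r"
  using assms
proof (induction S rule: finite_ne_induct)
  case (singleton x)
  then show ?case using order_facts(1) by (auto simp: refl_on_def)
next
  case (insert x S)
  then obtain u where u: "u \<in> S" "\<forall>v\<in>S. (v, u) \<in> r" by auto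
  have "(x, u) \<in> r \<or> (u, x) \<in> r"
    using order_facts(1,4) insert.prems u(1) by (cases "x = u") (auto simp: refl_on_def total_on_def)
  then show ?case
  proof
    assume "(u, x) \<in> r"
    then have "\<forall>v\<in>insert x S. (v, x) \<in> r"
      using u order_facts(1,2) insert.prems by (auto simp: refl_on_def dest: transD)
    then show ?thesis by blast
  qed (use u in auto)
qed

text \<open>The description in \<open>LM\<close> denotes: a greatest path exists because the finite
  set of paths of \<open>f\<close> is nonempty and totally ordered, and it is unique by
  antisymmetry.\<close>

lemma LM_props:
  assumes "f \<in> carrier R" "f \<noteq> 0"
  shows "LM r f \<in> Poly_Mapping.keys f" "\<And>v. v \<in> Poly_Mapping.keys f \<Longrightarrow> (v, LM r f) \<in> r"
proof -
  have "\<exists>u\<in>Poly_Mapping.keys f. \<forall>v\<in>Poly_Mapping.keys f. (v, u) \<in> r"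
    using assms by (intro finite_max) (auto simp: carrier_iff)
  then have "\<exists>!u. u \<in> Poly_Mapping.keys f \<and> (\<forall>v\<in>Poly_Mapping.keys f. (v, u) \<in> r)"
    using antisymD[OF order_facts(3)] by blast
  from theI'[OF this] show "LM r f \<in> Poly_Mapping.keys f" "\<And>v. v \<in> Poly_Mapping.keys f \<Longrightarrow> (v, LM r f) \<in> r"
    by (auto simp: LM_def)
qed

text \<open>A path of \<open>f\<close> longer than the leading one would be larger in the ordering.
  This is where gradedness ties the leading monomial to the degree.\<close>

lemma path_length_LM:
  assumes "f \<in> carrier R" "f \<noteq> 0"
  shows "path_length (LM r f) = pdeg f"
proof (rule antisym)
  show "path_length (LM r f) \<le> pdeg f" using LM_props(1)[OF assms] by (rule path_length_le_pdeg)
  show "pdeg f \<le> path_length (LM r f)"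
  proof (rule pdeg_le[OF assms(2)], rule ccontr)
    fix u assume u: "u \<in> Poly_Mapping.keys f" "\<not> path_length u \<le> path_length (LM r f)"
    then have "(LM r f, u) \<in> r"
      using LM_props(1)[OF assms] assms(1) by (intro order_graded) (auto simp: carrier_iff)
    then have "LM r f = u" using LM_props(2)[OF assms u(1)] antisymD[OF order_facts(3)] by blast
    then show False using u(2) by simp
  qed
qed

text \<open>The leading path of \<open>f\<close> lies in the ideal generated by the leading
  monomials of \<open>\<G>\<close>, which is contained in the ideal of elements supported on their
  multiples; its single path is then such a multiple.\<close>

lemma LM_multiple:
  assumes I: "ideal I R" and G: "groebner_basis Q r I \<G>" and f: "f \<in> I" "f \<noteq> 0"
  shows "LM r f \<in> monomial_multiples (LM r ` (\<G> - {0}))"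
proof -
  let ?M = "LM r ` (\<G> - {0})"
  let ?J = "{x \<in> carrier R. Poly_Mapping.keys x \<subseteq> monomial_multiples ?M}"
  have car: "I \<subseteq> carrier R" by (rule subsetI) (rule ideal.Icarr[OF I])
  have sub: "\<G> \<subseteq> I" and idl: "Idl (LM_set r I) = Idl (LM_set r \<G>)"
    using G by (simp_all add: groebner_basis_def R_eq)
  have LMp: "LM r g \<in> paths Q" if "g \<in> I" "g \<noteq> 0" for g
  proof -
    have "g \<in> carrier R" using that car by blast
    then show ?thesis using LM_props(1)[of g] that by (auto simp: carrier_iff)
  qed
  have "LM_set r \<G> \<subseteq> ?J"
  proof
    fix x assume "x \<in> LM_set r \<G>"
    then obtain g where g: "g \<in> \<G>" "g \<noteq> 0" "x = Poly_Mapping.single (LM r g) 1" by (auto simp: LM_set_def)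
    then have p: "LM r g \<in> paths Q" using LMp sub by blast
    have "LM r g \<in> monomial_multiples ?M"
      using g trivial_path[OF p]
      \<comment> \<open>The cofactors are the trivial paths at the two ends of
        \<open>LM r g\<close>.\<close>
      by (intro monomial_multiplesI[of "LM r g" _ "(fst (LM r g), [])" "(path_target Q (LM r g), [])"])
        (auto simp: trivial_path_concat)
    then show "x \<in> ?J" using g p by (simp add: single_closed)
  qed
  then have "Idl (LM_set r \<G>) \<subseteq> ?J" by (intro genideal_minimal ideal_monomial_multiples)
  moreover have "Poly_Mapping.single (LM r f) 1 \<in> Idl (LM_set r I)"
  proof -
    have "LM_set r I \<subseteq> carrier R" using LMp by (auto simp: LM_set_def single_closed)
    moreover have "Poly_Mapping.single (LM r f) 1 \<in> LM_set r I" using f by (auto simp: LM_set_def)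
    ultimately show ?thesis using genideal_self by blast
  qed
  ultimately show ?thesis using idl by auto
qed

end

text \<open>The cofactors are paths, with the scalar attached to the left one, so that degrees add
  up exactly. The bound \<open>p\<close> stays fixed along the induction. The case
  \<open>g = 0\<close> is excluded because \<open>pdeg 0\<close> is unspecified.\<close>

inductive_set (in path_ring) bounded_comb ::
    "(('v, 'e) path \<Rightarrow>\<^sub>0 'k) set \<Rightarrow> nat \<Rightarrow> (('v, 'e) path \<Rightarrow>\<^sub>0 'k) set" for G p where
  zero: "0 \<in> bounded_comb G p"
| step: "f \<in> bounded_comb G p \<Longrightarrow> g \<in> G \<Longrightarrow> g \<noteq> 0 \<Longrightarrow> w \<in> paths Q \<Longrightarrow> s \<in> paths Q \<Longrightarrow>
    path_length w + pdeg g + path_length s \<le> p \<Longrightarrow>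
    Poly_Mapping.single w c \<otimes> g \<otimes> Poly_Mapping.single s 1 + f \<in> bounded_comb G p"

context monomial_ordering
begin

text \<open>
  One reduction step subtracts the multiple \<open>c w g s\<close> of a basis element that cancels the leading
  term. Since the ordering is graded, \<open>\<bar>w\<bar> + d(g) + \<bar>s\<bar> = \<bar>LM f\<bar> = d(f)\<close>.
\<close>

lemma groebner_bounded_comb:
  assumes I: "ideal I R" and G: "groebner_basis Q r I \<G>" and f: "f \<in> I" "f \<noteq> 0" "pdeg f \<le> p"
  shows "f \<in> bounded_comb \<G> p"
  using f
proof (induction "LM r f" arbitrary: f rule: wf_induct_rule[OF order_facts(5)])
  case (1 f)
  have car: "x \<in> carrier R" if "x \<in> I" for x using ideal.Icarr[OF I that] .
  have sub: "\<G> \<subseteq> I" using G by (simp add: groebner_basis_def)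
  obtain g w s where g: "g \<in> \<G>" "g \<noteq> 0" and ws: "w \<in> paths Q" "s \<in> paths Q"
    and comp: "composable Q w (LM r g)" "composable Q (path_concat w (LM r g)) s"
    and LMf: "LM r f = path_concat (path_concat w (LM r g)) s"
  proof (rule monomial_multiplesE[OF LM_multiple[OF I G 1(2,3)]])
    fix w m s
    assume "LM r f = path_concat (path_concat w m) s" "m \<in> LM r ` (\<G> - {0})" "w \<in> paths Q" "s \<in> paths Q"
      "composable Q w m" "composable Q (path_concat w m) s"
    then show thesis using that by blast
  qed
  have gI: "g \<in> I" using g sub by blast
  note gp = LM_props[OF car[OF gI] g(2)]
  note fp = LM_props[OF car[OF 1(2)] 1(3)]
  have len: "path_length w + pdeg g + path_length s = pdeg f"
    using path_length_LM[OF car[OF gI] g(2)] path_length_LM[OF car[OF 1(2)] 1(3)] LMf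
    by (simp add: path_length_concat)
  \<comment> \<open>The quotient of the leading coefficients: the coefficient of \<open>m\<close> at
    \<open>LM r f\<close> is \<open>c\<close> times that of \<open>g\<close> at
    \<open>LM r g\<close>, hence equals that of \<open>f\<close>.\<close>
  define c where "c = Poly_Mapping.lookup f (LM r f) / Poly_Mapping.lookup g (LM r g)"
  define m where "m = Poly_Mapping.single w c \<otimes> g \<otimes> Poly_Mapping.single s 1"
  have mI: "m \<in> I"
    unfolding m_def using I gI ws by (intro ideal.I_l_closed[OF I] ideal.I_r_closed[OF I] single_closed)
  have f'I: "f - m \<in> I"
    using additive_subgroup.a_closed[OF ideal.axioms(1)[OF I] 1(2) additive_subgroup.a_inv_closed[OF ideal.axioms(1)[OF I] mI]]
      car[OF mI] by (simp add: uminus_eq add_eq)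
  have m_le: "(u, LM r f) \<in> r" if u: "u \<in> Poly_Mapping.keys m" for u
  proof -
    from u obtain v where v: "v \<in> Poly_Mapping.keys g" "composable Q w v" "composable Q (path_concat w v) s"
      "u = path_concat (path_concat w v) s"
      unfolding m_def by (rule keys_sandwich)
    have p: "v \<in> paths Q" "LM r g \<in> paths Q" using v(1) gp(1) car[OF gI] by (auto simp: carrier_iff)
    show ?thesis
    proof (cases "v = LM r g")
      case True
      then show ?thesis using v(4) LMf order_facts(1) fp car[OF 1(2)] by auto
    next
      case False
      then show ?thesis
        using v(2,3) p ws comp gp(2)[OF v(1)] unfolding LMf v(4) by (intro order_mult)
    qed
  qed
  have f'_le: "(u, LM r f) \<in> r" if "u \<in> Poly_Mapping.keys (f - m)" for u
  proof -
    have "u \<in> Poly_Mapping.keys f \<or> u \<in> Poly_Mapping.keys m"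
      using that by (auto simp: in_keys_iff lookup_minus)
    then show ?thesis using fp(2) m_le by blast
  qed
  have lc: "Poly_Mapping.lookup g (LM r g) \<noteq> 0" using gp(1) by (simp add: in_keys_iff)
  have notin: "LM r f \<notin> Poly_Mapping.keys (f - m)"
    using lc lookup_sandwich[OF comp, of c g] unfolding m_def LMf[symmetric]
    by (simp add: in_keys_iff lookup_minus c_def)
  have "f - m \<in> bounded_comb \<G> p"
  proof (cases "f - m = 0")
    case True
    then show ?thesis by (simp add: bounded_comb.zero)
  next
    case False
    note lm = LM_props[OF car[OF f'I] False]
    have lt: "(LM r (f - m), LM r f) \<in> r - Id" using f'_le[OF lm(1)] notin lm(1) by auto
    \<comment> \<open>A larger degree would mean a longer leading path, which gradedness places
      above \<open>LM r f\<close>, against the strict decrease in \<open>lt\<close>.\<close>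
    have "pdeg (f - m) \<le> pdeg f"
    proof (rule ccontr)
      assume "\<not> pdeg (f - m) \<le> pdeg f"
      then have "path_length (LM r f) < path_length (LM r (f - m))"
        using path_length_LM[OF car[OF f'I] False] path_length_LM[OF car[OF 1(2)] 1(3)] by simp
      moreover have "LM r f \<in> paths Q" "LM r (f - m) \<in> paths Q"
        using fp(1) lm(1) car[OF f'I] car[OF 1(2)] by (auto simp: carrier_iff)
      ultimately have "(LM r f, LM r (f - m)) \<in> r" by (intro order_graded)
      then show False using lt antisymD[OF order_facts(3)] by blast
    qed
    then show ?thesis using 1(1)[OF lt f'I False] 1(4) by simp
  qed
  then have "m + (f - m) \<in> bounded_comb \<G> p"
    unfolding m_def using g ws len 1(4) by (intro bounded_comb.step) auto
  then show ?case by simp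
qed

end

section \<open>The associated graded algebra of a quotient\<close>

context path_ring
begin

text \<open>The strict bound absorbs the index shift: \<open>below (Suc p)\<close> is the filtration
  step \<open>p\<close> of the path algebra, and \<open>below p\<close> is the preceding step also
  for \<open>p = 0\<close>, where it is the zero subspace.\<close>

definition below :: "nat \<Rightarrow> (('v, 'e) path \<Rightarrow>\<^sub>0 'k) set" where
  "below p = {f \<in> carrier R. \<forall>u\<in>Poly_Mapping.keys f. path_length u < p}"

lemma below_carrier: "f \<in> below p \<Longrightarrow> f \<in> carrier R"
  by (simp add: below_def)

lemma below_0: "below 0 = {0}"
proof -
  have "f \<in> below 0 \<longleftrightarrow> f = 0" for f
    unfolding keys_eq_empty[symmetric] by (auto simp: below_def carrier_iff simp del: keys_eq_empty)
  then show ?thesis by blast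
qed

lemma zero_carrier: "0 \<in> carrier R"
  by (simp add: carrier_iff)

lemma zero_below: "0 \<in> below p"
  by (simp add: below_def carrier_iff)

lemma add_below: "f \<in> below p \<Longrightarrow> g \<in> below p \<Longrightarrow> f + g \<in> below p"
  using a_closed[of f g] Poly_Mapping.keys_add[of f g] by (auto simp: below_def add_eq)

lemma uminus_below: "f \<in> below p \<Longrightarrow> - f \<in> below p"
  by (simp add: below_def carrier_iff)

lemma minus_below: "f \<in> below p \<Longrightarrow> g \<in> below p \<Longrightarrow> f - g \<in> below p"
  using add_below[of f p "- g"] uminus_below[of g p] by simp

lemma sum_below: "(\<And>i. i \<in> S \<Longrightarrow> f i \<in> below p) \<Longrightarrow> sum f S \<in> below p"
  by (induction S rule: infinite_finite_induct) (simp_all add: zero_below add_below)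

lemma smult_below: "f \<in> below p \<Longrightarrow> c \<odot> f \<in> below p"
  by (auto simp: below_def smult_closed in_keys_iff lookup_smult)

lemma mult_below: "f \<in> below (Suc p) \<Longrightarrow> g \<in> below (Suc q) \<Longrightarrow> f \<otimes> g \<in> below (Suc (p + q))"
proof -
  assume f: "f \<in> below (Suc p)" and g: "g \<in> below (Suc q)"
  have "path_length u < Suc (p + q)" if u: "u \<in> Poly_Mapping.keys (f \<otimes> g)" for u
  proof -
    obtain v w where "v \<in> Poly_Mapping.keys f" "w \<in> Poly_Mapping.keys g" "u = path_concat v w"
      using mult_keys[OF u] by blast
    then have "path_length v < Suc p" "path_length w < Suc q" "path_length u = path_length v + path_length w"
      using f g by (auto simp: below_def path_length_concat)
    then show ?thesis by simp
  qed
  then show ?thesis using f g by (simp add: below_def)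
qed

lemma below_mono: "f \<in> below p \<Longrightarrow> p \<le> q \<Longrightarrow> f \<in> below q"
  by (auto simp: below_def)

lemma below_pdeg: "f \<in> carrier R \<Longrightarrow> f \<in> below (Suc (pdeg f))"
  using path_length_le_pdeg[of _ f] by (auto simp: below_def less_Suc_eq_le)

lemma hcomp_below: "f \<in> carrier R \<Longrightarrow> hcomp p f \<in> below (Suc p)"
  by (auto simp: below_def hcomp_closed keys_hcomp)

lemma hcomp_below_eq_0: "f \<in> below p \<Longrightarrow> p \<le> q \<Longrightarrow> hcomp q f = 0"
  by (rule hcomp_eq_0) (auto simp: below_def)

lemma minus_hcomp_below:
  assumes "f \<in> below (Suc p)"
  shows "f - hcomp p f \<in> below p"
proof -
  have "path_length u < p" if "u \<in> Poly_Mapping.keys (f - hcomp p f)" for u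
  proof -
    have "path_length u \<noteq> p" "u \<in> Poly_Mapping.keys f"
      using that by (auto simp: in_keys_iff lookup_minus lookup_hcomp split: if_splits)
    then show ?thesis using assms by (force simp: below_def)
  qed
  then show ?thesis
    using minus_closed_class[OF _ hcomp_closed, of f f p] assms by (simp add: below_def)
qed

lemma sum_hcomp_below: "f \<in> below (Suc p) \<Longrightarrow> (\<Sum>i\<le>p. hcomp i f) = f"
  by (rule sum_hcomp) (auto simp: below_def)

lemma ideal_zero: "ideal J R \<Longrightarrow> 0 \<in> J"
  using additive_subgroup.zero_closed[OF ideal.axioms(1), of J R] by (simp add: zero_eq)

lemma ideal_sum: "ideal J R \<Longrightarrow> (\<And>i. i \<in> S \<Longrightarrow> f i \<in> J) \<Longrightarrow> sum f S \<in> J"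
proof (induction S rule: infinite_finite_induct)
  case (insert x S)
  then show ?case
    using additive_subgroup.a_closed[OF ideal.axioms(1)[OF insert.prems(1)], of "f x" "sum f S"]
    by (simp add: add_eq)
qed (simp_all add: ideal_zero)

end

section \<open>The quotient by an ideal and its induced filtration\<close>

locale path_ideal = path_ring Q R
  for Q :: "('v, 'e) pre_digraph" and R :: "('k::field, ('v, 'e) path \<Rightarrow>\<^sub>0 'k) module" (structure) +
  fixes I :: "(('v, 'e) path \<Rightarrow>\<^sub>0 'k) set"
  assumes ideal_I: "ideal I R"
begin

abbreviation A :: "('k, (('v, 'e) path \<Rightarrow>\<^sub>0 'k) set) module" where "A \<equiv> quot_algebra R I"

abbreviation FA :: "nat \<Rightarrow> (('v, 'e) path \<Rightarrow>\<^sub>0 'k) set set" where "FA \<equiv> quot_filtration Q I"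

abbreviation proj :: "(('v, 'e) path \<Rightarrow>\<^sub>0 'k) \<Rightarrow> (('v, 'e) path \<Rightarrow>\<^sub>0 'k) set" where "proj x \<equiv> I +> x"

lemma I_carrier: "x \<in> I \<Longrightarrow> x \<in> carrier R"
  using ideal.Icarr[OF ideal_I] .

lemma I_zero: "0 \<in> I"
  by (rule ideal_zero[OF ideal_I])

lemma abelian_subgroup_I: "abelian_subgroup I R"
  by (rule abelian_subgroupI3[OF ideal.axioms(1)[OF ideal_I] is_abelian_group])

lemma proj_eq_iff:
  "x \<in> carrier R \<Longrightarrow> y \<in> carrier R \<Longrightarrow> proj x = proj y \<longleftrightarrow> x - y \<in> I"
  using abelian_subgroup.a_rcos_eq_iff[OF abelian_subgroup_I, of x y] by (simp add: minus_eq)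

lemma proj_hom: "proj \<in> ring_hom R A"
  by (rule ring_hom_quot_algebra[OF ideal_I])

lemma ring_A: "ring A"
  by (rule ring_quot_algebra[OF ideal_I])

lemma proj_closed: "x \<in> carrier R \<Longrightarrow> proj x \<in> carrier A"
  using proj_hom by (auto simp: ring_hom_def)

lemma proj_add: "x \<in> carrier R \<Longrightarrow> y \<in> carrier R \<Longrightarrow> proj x \<oplus>\<^bsub>A\<^esub> proj y = proj (x + y)"
  using ring_hom_add[OF proj_hom, of x y] by (simp add: add_eq)

lemma proj_mult: "x \<in> carrier R \<Longrightarrow> y \<in> carrier R \<Longrightarrow> proj x \<otimes>\<^bsub>A\<^esub> proj y = proj (x \<otimes> y)"
  using ring_hom_mult[OF proj_hom, of x y] by simp

lemma proj_one: "\<one>\<^bsub>A\<^esub> = proj \<one>"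
  by (simp add: quot_algebra_simps)

lemma proj_zero: "\<zero>\<^bsub>A\<^esub> = proj 0"
  using a_coset_add_zero[of I] I_carrier by (auto simp: quot_algebra_simps zero_eq)

lemma proj_smult: "x \<in> carrier R \<Longrightarrow> c \<odot>\<^bsub>A\<^esub> proj x = proj (c \<odot> x)"
  by (rule smult_quot_algebra[OF ideal_I]) (simp_all add: smult_closed smult_ideal[OF ideal_I] smult_add add_eq)

lemma proj_finsum:
  "finite S \<Longrightarrow> (\<And>i. i \<in> S \<Longrightarrow> f i \<in> carrier R) \<Longrightarrow> finsum A (\<lambda>i. proj (f i)) S = proj (sum f S)"
proof (induction S rule: finite_induct)
  case empty
  interpret A: ring A by (rule ring_A)
  show ?case by (simp flip: proj_zero)
next
  case (insert x S)
  interpret A: ring A by (rule ring_A)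
  show ?case
    using insert by (simp add: A.finsum_insert Pi_def proj_closed proj_add sum_closed)
qed

lemma FA_eq: "FA p = proj ` below (Suc p)"
proof -
  have "path_filtration Q p = below (Suc p)"
    by (simp add: path_filtration_def below_def less_Suc_eq_le flip: R_eq)
  then have FA: "FA p = proj ` (below (Suc p) <+> I)"
    by (simp add: quot_filtration_def flip: R_eq)
  have "proj (f + i) = proj f" if "f \<in> below (Suc p)" "i \<in> I" for f i
    using that a_closed[of f i] proj_eq_iff[of "f + i" f] by (simp add: below_carrier I_carrier add_eq)
  then show ?thesis
    unfolding FA set_add_def' using I_zero
    by (auto simp: add_eq image_iff)
qed

lemma filtered_ring_A: "filtered_ring A FA"
proof (rule filtered_ring.intro[OF ring_A], rule filtered_ring_axioms.intro)
  interpret proj: ring_hom_ring R A proj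
    by (rule ring_hom_ringI2[OF ring_axioms ring_A proj_hom])
  fix p q x y
  have "subgroup (below (Suc p)) (add_monoid R)"
  proof (rule subgroup.intro)
    fix x assume "x \<in> below (Suc p)"
    then show "inv\<^bsub>add_monoid R\<^esub> x \<in> below (Suc p)"
      using uminus_below by (simp add: uminus_eq below_carrier flip: a_inv_def)
  qed (auto simp: below_carrier zero_eq add_eq zero_below add_below)
  then show "additive_subgroup (FA p) A"
    unfolding FA_eq by (intro additive_subgroupI proj.img_is_add_subgroup)
  show "FA p \<subseteq> FA (Suc p)" unfolding FA_eq
    by (intro image_mono subsetI, erule below_mono) simp
  show "x \<otimes>\<^bsub>A\<^esub> y \<in> FA (p + q)" if "x \<in> FA p" "y \<in> FA q"
  proof -
    from that obtain f g where f: "f \<in> below (Suc p)" "x = proj f" and g: "g \<in> below (Suc q)" "y = proj g"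
      unfolding FA_eq by blast
    then have "x \<otimes>\<^bsub>A\<^esub> y = proj (f \<otimes> g)" by (simp only: proj_mult below_carrier)
    then show ?thesis using mult_below[OF f(1) g(1)] unfolding FA_eq by blast
  qed
qed

end

sublocale path_ideal \<subseteq> FA: filtered_ring A FA
  by (rule filtered_ring_A)

context path_ideal
begin

lemma N_eq: "FA.N p = proj ` below p"
  by (cases p) (simp_all add: filt_pred_def FA_eq below_0 proj_zero)

lemma cls_cong:
  assumes "x \<in> carrier R" "y \<in> carrier R" "x - y \<in> below p"
  shows "FA.N p +>\<^bsub>A\<^esub> proj x = FA.N p +>\<^bsub>A\<^esub> proj y"
proof -
  have "proj (x - y) \<oplus>\<^bsub>A\<^esub> proj y = proj x" using assms by (simp add: proj_add minus_closed_class)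
  then have "proj x \<in> FA.N p +>\<^bsub>A\<^esub> proj y" using assms(3) unfolding N_eq a_r_coset_def' by force
  then show ?thesis
    using abelian_subgroup.a_repr_independence'[OF FA.N_subgroup] proj_closed assms(2) by blast
qed

lemma cls_zero: "FA.N p +>\<^bsub>A\<^esub> proj 0 = FA.N p"
  unfolding proj_zero[symmetric] using FA.N_carrier by (intro FA.a_coset_add_zero) blast

lemma natural_map_eq: "natural_map Q I f = FA.cls (\<lambda>p. proj (hcomp p f))"
  by (simp add: natural_map_def Let_def flip: R_eq)

lemma proj_hcomp_FA: "f \<in> carrier R \<Longrightarrow> proj (hcomp p f) \<in> FA p"
  unfolding FA_eq using hcomp_below by blast

lemma natural_map_closed:
  assumes "f \<in> carrier R"
  shows "natural_map Q I f \<in> carrier (assoc_graded A FA)"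
proof -
  have "{p. natural_map Q I f p \<noteq> FA.N p} \<subseteq> path_length ` Poly_Mapping.keys f"
  proof
    fix p assume "p \<in> {p. natural_map Q I f p \<noteq> FA.N p}"
    then have "hcomp p f \<noteq> 0" using cls_zero by (auto simp: natural_map_eq)
    then show "p \<in> path_length ` Poly_Mapping.keys f" using hcomp_eq_0[of f p] by blast
  qed
  then have "finite {p. natural_map Q I f p \<noteq> FA.N p}" by (rule finite_subset) simp
  then show ?thesis
    using proj_hcomp_FA[OF assms] by (auto simp: assoc_graded_def natural_map_eq)
qed

lemma ring_morphism_natural_map: "ring_morphism R (assoc_graded A FA) (natural_map Q I)"
proof (intro ring_morphism.intro ring_axioms ring_morphism_axioms.intro ring_hom_memI)
  fix f g assume f: "f \<in> carrier R" and g: "g \<in> carrier R"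
  have "(\<Oplus>\<^bsub>A\<^esub>i\<in>{..p}. proj (hcomp i f) \<otimes>\<^bsub>A\<^esub> proj (hcomp (p - i) g)) = proj (hcomp p (f \<otimes> g))" for p
    using f g by (simp add: proj_mult hcomp_closed proj_finsum hcomp_mult)
  then show "natural_map Q I (f \<otimes> g) = natural_map Q I f \<otimes>\<^bsub>assoc_graded A FA\<^esub> natural_map Q I g"
    using FA.mult_cls[OF proj_hcomp_FA[OF f] proj_hcomp_FA[OF g]] by (simp add: natural_map_eq)
  show "natural_map Q I (f \<oplus> g) = natural_map Q I f \<oplus>\<^bsub>assoc_graded A FA\<^esub> natural_map Q I g"
    using FA.add_cls[OF proj_hcomp_FA[OF f] proj_hcomp_FA[OF g]] f g
    by (simp add: natural_map_eq add_eq hcomp_add proj_add hcomp_closed)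
next
  show "natural_map Q I \<one> = \<one>\<^bsub>assoc_graded A FA\<^esub>"
    by (auto simp: fun_eq_iff natural_map_eq assoc_graded_def hcomp_one proj_one proj_zero)
qed (rule natural_map_closed)

lemma natural_map_smult:
  assumes f: "f \<in> carrier R"
  shows "natural_map Q I (c \<odot> f) = c \<odot>\<^bsub>assoc_graded A FA\<^esub> natural_map Q I f"
proof -
  have "c \<odot>\<^bsub>assoc_graded A FA\<^esub> natural_map Q I f = FA.cls (\<lambda>p. c \<odot>\<^bsub>A\<^esub> proj (hcomp p f))"
    unfolding natural_map_eq
  proof (rule FA.smult_cls[OF proj_hcomp_FA[OF f]])
    fix p x assume "x \<in> FA p"
    then show "c \<odot>\<^bsub>A\<^esub> x \<in> FA p"
      unfolding FA_eq by (auto simp: proj_smult below_carrier intro: smult_below)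
  next
    show "c \<odot>\<^bsub>A\<^esub> \<zero>\<^bsub>A\<^esub> = \<zero>\<^bsub>A\<^esub>"
      using proj_smult[of 0 c] by (simp add: proj_zero smult_zero carrier_iff)
  next
    fix x y assume "x \<in> carrier A" "y \<in> carrier A"
    then show "c \<odot>\<^bsub>A\<^esub> (x \<oplus>\<^bsub>A\<^esub> y) = c \<odot>\<^bsub>A\<^esub> x \<oplus>\<^bsub>A\<^esub> c \<odot>\<^bsub>A\<^esub> y"
      using a_closed by (auto simp: carrier_quot_algebra proj_add proj_smult smult_closed smult_add add_eq)
  qed
  then show ?thesis using f by (simp add: natural_map_eq proj_smult hcomp_closed hcomp_smult)
qed

text \<open>In each degree the top component of a representative suffices, since the rest is killed
  by the lower filtration step. Choosing zero wherever \<open>x\<close> vanishes makes the sum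
  finite and makes homogeneous elements lift to homogeneous ones.\<close>

lemma natural_map_surj:
  assumes "x \<in> carrier (assoc_graded A FA)"
  obtains f where "f \<in> carrier R" "natural_map Q I f = x"
    "\<And>p. x p = FA.N p \<Longrightarrow> hcomp p f = 0"
proof -
  have x: "\<exists>f\<in>below (Suc p). x p = FA.N p +>\<^bsub>A\<^esub> proj f" and fin: "finite {p. x p \<noteq> FA.N p}" for p
    using assms by (auto simp: assoc_graded_def FA_eq)
  from x have "\<forall>p. \<exists>f\<in>below (Suc p). x p = FA.N p +>\<^bsub>A\<^esub> proj f" by blast
  then obtain c where c: "\<And>p. c p \<in> below (Suc p)" "\<And>p. x p = FA.N p +>\<^bsub>A\<^esub> proj (c p)"
    by metis
  define f where "f = (\<Sum>p\<in>{p. x p \<noteq> FA.N p}. hcomp p (c p))"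
  have hf: "hcomp p f = (if x p \<noteq> FA.N p then hcomp p (c p) else 0)" for p
    using fin by (simp add: f_def hcomp_sum hcomp_hcomp)
  have "natural_map Q I f p = x p" for p
  proof (cases "x p = FA.N p")
    case True
    then show ?thesis by (simp add: natural_map_eq hf cls_zero)
  next
    case False
    have "c p \<in> carrier R" using below_carrier[OF c(1)] .
    then show ?thesis
      using False c cls_cong[OF _ _ minus_hcomp_below[OF c(1)[of p]]]
      by (simp add: natural_map_eq hf hcomp_closed)
  qed
  moreover have "f \<in> carrier R"
    unfolding f_def by (intro sum_closed hcomp_closed below_carrier) (rule c)
  ultimately show thesis using that[of f] hf by auto
qed

lemma natural_map_eq_zero_iff:
  assumes "f \<in> carrier R"
  shows "natural_map Q I f = natural_map Q I 0 \<longleftrightarrow> (\<forall>p. \<exists>b\<in>below p. hcomp p f - b \<in> I)"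
proof -
  have "FA.N p +>\<^bsub>A\<^esub> proj (hcomp p f) = FA.N p \<longleftrightarrow> (\<exists>b\<in>below p. hcomp p f - b \<in> I)" for p
  proof -
    have c: "proj (hcomp p f) \<in> carrier A" using assms by (simp add: proj_closed hcomp_closed)
    have "FA.N p +>\<^bsub>A\<^esub> proj (hcomp p f) = FA.N p \<longleftrightarrow> proj (hcomp p f) \<in> FA.N p"
      using abelian_subgroup.a_rcos_self[OF FA.N_subgroup c, of p]
        abelian_subgroup.a_rcos_const[OF FA.N_subgroup, of "proj (hcomp p f)" p] by blast
    also have "\<dots> \<longleftrightarrow> (\<exists>b\<in>below p. hcomp p f - b \<in> I)"
      using assms by (auto simp: N_eq image_iff proj_eq_iff hcomp_closed below_carrier)
    finally show ?thesis .
  qed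
  then show ?thesis by (auto simp: natural_map_eq hcomp_zero cls_zero fun_eq_iff)
qed

text \<open>A component of degree \<open>p\<close> dies in the graded algebra iff it differs from an
  element of \<open>I\<close> by some \<open>b\<close> of lower degree. If the component is nonzero,
  it is then the leading form of that element of \<open>I\<close>; summing over \<open>p\<close>
  gives the kernel.\<close>

lemma kern_natural_map:
  "ring_morphism.kern R (natural_map Q I) = Idl (LH ` I)" (is "?K = ?L")
proof
  interpret NM: ring_morphism R "assoc_graded A FA" "natural_map Q I"
    by (rule ring_morphism_natural_map)
  have K: "f \<in> ?K \<longleftrightarrow> f \<in> carrier R \<and> (\<forall>p. \<exists>b\<in>below p. hcomp p f - b \<in> I)" for f
    using natural_map_eq_zero_iff[of f] by (auto simp: NM.kern_def zero_eq)
  have LHc: "LH ` I \<subseteq> carrier R" using I_carrier by (auto simp: LH_def hcomp_closed zero_carrier)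
  have "LH f \<in> ?K" if f: "f \<in> I" for f
  proof -
    have "\<exists>b\<in>below p. hcomp p (LH f) - b \<in> I" for p
    proof (cases "f \<noteq> 0 \<and> p = pdeg f")
      case True
      then have "LH f = hcomp p f" by (simp add: LH_def)
      moreover have "f - hcomp p f \<in> below p"
        using True minus_hcomp_below below_pdeg[OF I_carrier[OF f]] by simp
      then have "hcomp p f - f \<in> below p" using uminus_below[of "f - hcomp p f"] by simp
      \<comment> \<open>The witness \<open>hcomp p f - f\<close> is minus the lower part of
        \<open>f\<close>; subtracting it from the leading form returns \<open>f\<close>, which is in
        \<open>I\<close>.\<close>
      ultimately show ?thesis using f by (intro bexI[of _ "hcomp p f - f"]) (simp_all add: hcomp_hcomp)
    next
      case False
      then have "hcomp p (LH f) = 0" by (auto simp: LH_def hcomp_hcomp hcomp_zero)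
      then show ?thesis using zero_below I_zero by (intro bexI[of _ 0]) simp_all
    qed
    then show ?thesis using LHc f K by blast
  qed
  then show "?L \<subseteq> ?K" using NM.ideal_kern by (intro genideal_minimal) auto
  have L: "ideal ?L R" by (rule genideal_ideal[OF LHc])
  show "?K \<subseteq> ?L"
  proof
    fix f assume f: "f \<in> ?K"
    have "hcomp p f \<in> ?L" for p
    proof (cases "hcomp p f = 0")
      case True
      then show ?thesis using ideal_zero[OF L] by simp
    next
      case False
      from f K obtain b where b: "b \<in> below p" "hcomp p f - b \<in> I" by blast
      let ?i = "hcomp p f - b"
      have h: "hcomp p ?i = hcomp p f"
        using b(1) hcomp_below_eq_0[of b p p] by (simp add: hcomp_minus hcomp_hcomp)
      then have ne: "?i \<noteq> 0" using False by (metis hcomp_zero)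
      have "?i \<in> below (Suc p)"
        using f K b(1) by (intro minus_below hcomp_below below_mono[OF b(1)]) auto
      then have "pdeg ?i \<le> p" using ne by (intro pdeg_le) (auto simp: below_def)
      moreover have "\<not> pdeg ?i < p"
      proof
        assume "pdeg ?i < p"
        then have "hcomp p ?i = 0" using path_length_le_pdeg[of _ ?i] by (intro hcomp_eq_0) fastforce
        then show False using h False by simp
      qed
      ultimately have "LH ?i = hcomp p f" using ne h by (simp add: LH_def)
      then show ?thesis using b(2) genideal_self[OF LHc] by (metis image_subset_iff)
    qed
    then have "(\<Sum>p\<le>pdeg f. hcomp p f) \<in> ?L" by (intro ideal_sum L)
    then show "f \<in> ?L" using f K sum_hcomp_below[OF below_pdeg] by simp
  qed
qed

lemma homogeneous_part_eq: "homogeneous_part Q p = {f \<in> carrier R. \<forall>i. i \<noteq> p \<longrightarrow> hcomp i f = 0}"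
proof -
  have "(\<forall>u\<in>Poly_Mapping.keys f. path_length u = p) \<longleftrightarrow> (\<forall>i. i \<noteq> p \<longrightarrow> hcomp i f = 0)" for f :: "('v, 'e) path \<Rightarrow>\<^sub>0 'k"
    unfolding keys_eq_empty[symmetric] keys_hcomp by blast
  then show ?thesis by (auto simp: homogeneous_part_def R_eq)
qed

lemma natural_map_graded:
  "natural_map Q I ` homogeneous_part Q p = assoc_graded_part A FA p"
proof
  show "natural_map Q I ` homogeneous_part Q p \<subseteq> assoc_graded_part A FA p"
    using natural_map_closed by (auto simp: homogeneous_part_eq assoc_graded_part_def natural_map_eq cls_zero)
  show "assoc_graded_part A FA p \<subseteq> natural_map Q I ` homogeneous_part Q p"
  proof
    fix x assume x: "x \<in> assoc_graded_part A FA p"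
    then have "x \<in> carrier (assoc_graded A FA)" by (simp add: assoc_graded_part_def)
    then obtain f where f: "f \<in> carrier R" "natural_map Q I f = x" "\<And>p. x p = FA.N p \<Longrightarrow> hcomp p f = 0"
      using natural_map_surj by metis
    then have "f \<in> homogeneous_part Q p" using x by (simp add: homogeneous_part_eq assoc_graded_part_def)
    then show "x \<in> natural_map Q I ` homogeneous_part Q p" using f by blast
  qed
qed

lemma natural_map_image: "natural_map Q I ` carrier R = carrier (assoc_graded A FA)"
  using natural_map_closed natural_map_surj by blast

lemma homogeneous_part_subset: "homogeneous_part Q p \<subseteq> carrier R"
  by (auto simp: homogeneous_part_eq)

lemma natural_rho_iso:
  "natural_rho Q I \<in> graded_iso (quot_algebra R (Idl (LH ` I))) (quot_grading R (Idl (LH ` I)) (homogeneous_part Q))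
    (assoc_graded A FA) (assoc_graded_part A FA)"
  using ring_morphism.graded_iso_quot[OF ring_morphism_natural_map natural_map_image smult_closed natural_map_smult
      homogeneous_part_subset natural_map_graded]
  by (simp add: kern_natural_map natural_rho_def[abs_def])

lemma assoc_graded_isomorphic:
  "graded_isomorphic (assoc_graded A FA) (assoc_graded_part A FA)
    (quot_algebra R (Idl (LH ` I))) (quot_grading R (Idl (LH ` I)) (homogeneous_part Q))"
  using ring_morphism.graded_isomorphic_quot[OF ring_morphism_natural_map natural_map_image smult_closed natural_map_smult
      homogeneous_part_subset natural_map_graded]
  by (simp add: kern_natural_map)

end

section \<open>Homogenization\<close>

lemma (in ring) mem_up_iff: "x \<in> up R \<longleftrightarrow> (\<forall>j. x j \<in> carrier R) \<and> (\<exists>n. \<forall>j>n. x j = \<zero>)"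
  by (auto simp: up_def bound_def)

context path_ring
begin

abbreviation Rt :: "('k, nat \<Rightarrow> ('v, 'e) path \<Rightarrow>\<^sub>0 'k) module" where "Rt \<equiv> poly_algebra R"

lemma Rt_carrier: "x \<in> carrier Rt \<longleftrightarrow> (\<forall>j. x j \<in> carrier R) \<and> (\<exists>n. \<forall>j>n. x j = 0)"
  by (simp add: poly_algebra_def UP_def mem_up_iff zero_eq)

lemma Rt_zero: "\<zero>\<^bsub>Rt\<^esub> = (\<lambda>j. 0)"
  by (simp add: poly_algebra_def UP_def zero_eq)

lemma Rt_one: "\<one>\<^bsub>Rt\<^esub> = (\<lambda>j. if j = 0 then \<one> else 0)"
  by (auto simp: poly_algebra_def UP_def zero_eq)

lemma Rt_smult: "c \<odot>\<^bsub>Rt\<^esub> x = (\<lambda>j. c \<odot> x j)"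
  by (simp add: poly_algebra_def)

lemma Rt_add: "x \<in> carrier Rt \<Longrightarrow> y \<in> carrier Rt \<Longrightarrow> x \<oplus>\<^bsub>Rt\<^esub> y = (\<lambda>j. x j + y j)"
  by (simp add: poly_algebra_def UP_def add_eq)

lemma Rt_mult:
  assumes "x \<in> carrier Rt" "y \<in> carrier Rt"
  shows "x \<otimes>\<^bsub>Rt\<^esub> y = (\<lambda>j. \<Sum>i\<le>j. x i \<otimes> y (j - i))"
proof
  fix j
  have "(x \<otimes>\<^bsub>Rt\<^esub> y) j = (\<Oplus>i\<in>{..j}. x i \<otimes> y (j - i))"
    using assms by (simp add: poly_algebra_def UP_def)
  also have "\<dots> = (\<Sum>i\<le>j. x i \<otimes> y (j - i))"
    using assms by (intro finsum_eq_sum) (auto simp: Rt_carrier)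
  finally show "(x \<otimes>\<^bsub>Rt\<^esub> y) j = (\<Sum>i\<le>j. x i \<otimes> y (j - i))" .
qed

lemma ring_Rt: "ring Rt"
proof -
  have "UP_ring R" by (intro UP_ring.intro ring_axioms)
  from UP_ring.UP_ring[OF this] show ?thesis
    by (rule ring_cong) (simp_all add: poly_algebra_def)
qed

text \<open>This is the monomial of \<open>R[t]\<close> with coefficient \<open>c\<close> and
  exponent \<open>k\<close>.\<close>

definition coeff_elem :: "(('v, 'e) path \<Rightarrow>\<^sub>0 'k) \<Rightarrow> nat \<Rightarrow> nat \<Rightarrow> ('v, 'e) path \<Rightarrow>\<^sub>0 'k" where
  "coeff_elem c k = (\<lambda>j. if j = k then c else 0)"

lemma coeff_elem_closed: "c \<in> carrier R \<Longrightarrow> coeff_elem c k \<in> carrier Rt"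
  by (auto simp: Rt_carrier coeff_elem_def zero_carrier)

lemma coeff_elem_mult:
  assumes "c \<in> carrier R" "x \<in> carrier Rt"
  shows "coeff_elem c k \<otimes>\<^bsub>Rt\<^esub> x = (\<lambda>j. if k \<le> j then c \<otimes> x (j - k) else 0)"
proof
  fix j
  have "(\<Sum>i\<le>j. coeff_elem c k i \<otimes> x (j - i)) = (\<Sum>i\<le>j. if i = k then c \<otimes> x (j - k) else 0)"
    by (intro sum.cong) (auto simp: coeff_elem_def mult_zero)
  then show "(coeff_elem c k \<otimes>\<^bsub>Rt\<^esub> x) j = (if k \<le> j then c \<otimes> x (j - k) else 0)"
    using assms by (simp add: Rt_mult coeff_elem_closed)
qed

text \<open>Exponent 0 is enough on the right: \<open>t\<close> commutes with everything, so its
  powers are always collected in the left factor.\<close>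

lemma mult_coeff_elem:
  assumes "c \<in> carrier R" "x \<in> carrier Rt"
  shows "x \<otimes>\<^bsub>Rt\<^esub> coeff_elem c 0 = (\<lambda>j. x j \<otimes> c)"
proof
  fix j
  have "(\<Sum>i\<le>j. x i \<otimes> coeff_elem c 0 (j - i)) = (\<Sum>i\<le>j. if i = j then x j \<otimes> c else 0)"
    by (intro sum.cong) (auto simp: coeff_elem_def mult_zero)
  then show "(x \<otimes>\<^bsub>Rt\<^esub> coeff_elem c 0) j = x j \<otimes> c"
    using assms by (simp add: Rt_mult coeff_elem_closed)
qed

lemma ideal_Rt_zero: "ideal J Rt \<Longrightarrow> (\<lambda>j. 0) \<in> J"
  using additive_subgroup.zero_closed[OF ideal.axioms(1), of J Rt] by (simp add: Rt_zero)

lemma ideal_Rt_add: "ideal J Rt \<Longrightarrow> x \<in> J \<Longrightarrow> y \<in> J \<Longrightarrow> (\<lambda>j. x j + y j) \<in> J"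
  using additive_subgroup.a_closed[OF ideal.axioms(1), of J Rt x y] Rt_add[of x y]
    ideal.Icarr[of J Rt x] ideal.Icarr[of J Rt y] by simp

lemma ideal_Rt_sum:
  "ideal J Rt \<Longrightarrow> finite S \<Longrightarrow> (\<And>i. i \<in> S \<Longrightarrow> x i \<in> J) \<Longrightarrow> (\<lambda>j. \<Sum>i\<in>S. x i j) \<in> J"
  by (rotate_tac, induction S rule: finite_induct) (simp_all add: ideal_Rt_zero ideal_Rt_add)

text \<open>Homogenization to a prescribed degree: for nonzero \<open>f\<close> of degree at most
  \<open>p\<close> it is the homogenization of \<open>f\<close> times \<open>t\<close> to the power
  \<open>p - pdeg f\<close>. With \<open>p\<close> fixed it is additive in \<open>f\<close>.\<close>

definition homog_at :: "nat \<Rightarrow> (('v, 'e) path \<Rightarrow>\<^sub>0 'k) \<Rightarrow> nat \<Rightarrow> ('v, 'e) path \<Rightarrow>\<^sub>0 'k" where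
  "homog_at p f = (\<lambda>j. if j \<le> p then hcomp (p - j) f else 0)"

text \<open>Substitutes \<open>t = 1\<close> in the homogeneous component of degree \<open>p\<close>.\<close>

definition dehomog :: "nat \<Rightarrow> (nat \<Rightarrow> ('v, 'e) path \<Rightarrow>\<^sub>0 'k) \<Rightarrow> ('v, 'e) path \<Rightarrow>\<^sub>0 'k" where
  "dehomog p x = (\<Sum>j\<le>p. hcomp (p - j) (x j))"

text \<open>The unspecified value \<open>pdeg 0\<close> does no harm, since all components of 0
  vanish.\<close>

lemma homogenization_eq: "homogenization f = homog_at (pdeg f) f"
  by (auto simp: homogenization_def homog_at_def hcomp_zero)

lemma homog_at_closed: "f \<in> carrier R \<Longrightarrow> homog_at p f \<in> carrier Rt"
  unfolding Rt_carrier
  by (intro conjI exI[of _ p]) (auto simp: homog_at_def hcomp_closed zero_carrier)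

lemma homogenization_closed: "f \<in> carrier R \<Longrightarrow> homogenization f \<in> carrier Rt"
  by (simp add: homogenization_eq homog_at_closed)

lemma homog_at_add: "homog_at p (f + g) = (\<lambda>j. homog_at p f j + homog_at p g j)"
  by (auto simp: homog_at_def hcomp_add)

lemma homog_at_zero: "homog_at p 0 = (\<lambda>j. 0)"
  by (auto simp: homog_at_def hcomp_zero)

lemma homog_at_eq_mult:
  assumes f: "f \<in> carrier R" "f \<noteq> 0" "pdeg f \<le> p"
  shows "homog_at p f = coeff_elem \<one> (p - pdeg f) \<otimes>\<^bsub>Rt\<^esub> homogenization f"
proof
  fix j
  have below: "hcomp (p - j) f = 0" if "j < p - pdeg f"
    using that by (intro hcomp_below_eq_0[OF below_pdeg[OF f(1)]]) simp
  have "(coeff_elem \<one> (p - pdeg f) \<otimes>\<^bsub>Rt\<^esub> homogenization f) j =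
      (if p - pdeg f \<le> j \<and> j - (p - pdeg f) \<le> pdeg f then hcomp (pdeg f - (j - (p - pdeg f))) f else 0)"
    using f unfolding coeff_elem_mult[OF one_closed homogenization_closed[OF f(1)]]
    by (simp add: homogenization_eq homog_at_def hcomp_closed zero_carrier flip: zero_eq)
  also have "\<dots> = homog_at p f j"
    using f(3) below by (auto simp: homog_at_def not_le)
  finally show "homog_at p f j = (coeff_elem \<one> (p - pdeg f) \<otimes>\<^bsub>Rt\<^esub> homogenization f) j" ..
qed

lemma homog_at_in_ideal:
  assumes J: "ideal J Rt" and f: "f \<in> carrier R" "homogenization f \<in> J" "f \<in> below (Suc p)"
  shows "homog_at p f \<in> J"
proof (cases "f = 0")
  case True
  then show ?thesis using ideal_Rt_zero[OF J] by (simp add: homog_at_zero)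
next
  case False
  then have "pdeg f \<le> p" using f(3) by (intro pdeg_le) (auto simp: below_def)
  then show ?thesis
    using False f J by (simp add: homog_at_eq_mult ideal.I_l_closed coeff_elem_closed)
qed

lemma dehomog_closed: "x \<in> carrier Rt \<Longrightarrow> dehomog p x \<in> carrier R"
  unfolding dehomog_def by (intro sum_closed hcomp_closed) (auto simp: Rt_carrier)

lemma dehomog_below: "x \<in> carrier Rt \<Longrightarrow> dehomog p x \<in> below (Suc p)"
  unfolding dehomog_def
  by (intro sum_below below_mono[OF hcomp_below]) (auto simp: Rt_carrier)

lemma dehomog_add: "dehomog p (\<lambda>j. x j + y j) = dehomog p x + dehomog p y"
  by (simp add: dehomog_def hcomp_add sum.distrib)

lemma dehomog_sum: "dehomog p (\<lambda>j. \<Sum>i\<in>S. x i j) = (\<Sum>i\<in>S. dehomog p (x i))"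
  unfolding dehomog_def hcomp_sum by (rule sum.swap)

lemma dehomog_smult: "dehomog p (\<lambda>j. c \<odot> x j) = c \<odot> dehomog p x"
  by (simp add: dehomog_def hcomp_smult smult_sum)

lemma dehomog_zero: "dehomog p (\<lambda>j. 0) = 0"
  by (simp add: dehomog_def hcomp_zero)

lemma dehomog_one: "dehomog p \<one>\<^bsub>Rt\<^esub> = (if p = 0 then \<one> else 0)"
proof -
  have "dehomog p \<one>\<^bsub>Rt\<^esub> = (\<Sum>j\<le>p. if j = 0 then hcomp p \<one> else 0)"
    unfolding dehomog_def Rt_one by (intro sum.cong) (auto simp: hcomp_zero)
  then show ?thesis by (simp add: hcomp_one)
qed

text \<open>The coefficient of exponent \<open>j\<close> lives in degree \<open>p - j\<close> only,
  so the total degree is \<open>p\<close> throughout and no other degree \<open>q\<close> sees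
  anything.\<close>

lemma dehomog_homog_at:
  assumes "f \<in> below (Suc p)"
  shows "dehomog q (homog_at p f) = (if q = p then f else 0)"
proof (cases "q = p")
  case True
  have "dehomog p (homog_at p f) = (\<Sum>j\<le>p. hcomp (p - j) f)"
    unfolding dehomog_def by (intro sum.cong) (auto simp: homog_at_def hcomp_hcomp)
  also have "\<dots> = (\<Sum>j\<le>p. hcomp j f)"
    by (rule sum.reindex_bij_witness[where i = "\<lambda>j. p - j" and j = "\<lambda>j. p - j"]) auto
  finally show ?thesis using True sum_hcomp_below[OF assms] by simp
next
  case False
  then show ?thesis
    unfolding dehomog_def by (auto simp: homog_at_def hcomp_hcomp hcomp_zero intro!: sum.neutral)
qed

text \<open>The composite is the projection of \<open>R[t]\<close> onto its homogeneous component of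
  degree \<open>p\<close>: setting \<open>t = 1\<close> loses nothing once the total degree is
  fixed.\<close>

lemma homog_at_dehomog: "homog_at p (dehomog p x) = (\<lambda>j. if j \<le> p then hcomp (p - j) (x j) else 0)"
proof
  fix j
  have "hcomp (p - j) (dehomog p x) = (\<Sum>i\<le>p. if i = j then hcomp (p - j) (x j) else 0)" if "j \<le> p"
    unfolding dehomog_def hcomp_sum using that by (intro sum.cong) (auto simp: hcomp_hcomp)
  then show "homog_at p (dehomog p x) j = (if j \<le> p then hcomp (p - j) (x j) else 0)"
    by (simp add: homog_at_def)
qed

text \<open>Both sides are the sum of \<open>x\<^bsub>a,k\<^esub> y\<^bsub>b,l\<^esub>\<close> over all \<open>a + b + k + l = p\<close>.\<close>

lemma dehomog_mult:
  assumes "x \<in> carrier Rt" "y \<in> carrier Rt"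
  shows "dehomog p (x \<otimes>\<^bsub>Rt\<^esub> y) = (\<Sum>q\<le>p. dehomog q x \<otimes> dehomog (p - q) y)"
proof -
  define S where "S = (SIGMA j:{..p}. {..j} \<times> {..p - j})"
  have "dehomog p (x \<otimes>\<^bsub>Rt\<^esub> y) =
      (\<Sum>j\<le>p. \<Sum>a\<le>j. \<Sum>k\<le>p - j. hcomp k (x a) \<otimes> hcomp (p - j - k) (y (j - a)))"
    by (simp add: dehomog_def Rt_mult[OF assms] hcomp_sum hcomp_mult)
  also have "\<dots> = (\<Sum>(j, a, k)\<in>S. hcomp k (x a) \<otimes> hcomp (p - j - k) (y (j - a)))"
    by (simp add: S_def sum.Sigma sum.cartesian_product)
  also have "\<dots> = (\<Sum>(q, a, b)\<in>S. hcomp (q - a) (x a) \<otimes> hcomp (p - q - b) (y b))"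
    \<comment> \<open>The new index \<open>q = a + k\<close> is the total degree of the first factor
      and \<open>b = j - a\<close> the exponent of \<open>t\<close> in the second. The substitution
      is an involution of \<open>S\<close>, so one index set serves both sums.\<close>
    by (rule sum.reindex_bij_witness[where i = "\<lambda>(q, a, b). (a + b, a, q - a)" and j = "\<lambda>(j, a, k). (a + k, a, j - a)"])
      (auto simp: S_def intro!: arg_cong2[where f = "(\<otimes>)"] arg_cong2[where f = hcomp])
  also have "\<dots> = (\<Sum>q\<le>p. \<Sum>a\<le>q. \<Sum>b\<le>p - q. hcomp (q - a) (x a) \<otimes> hcomp (p - q - b) (y b))"
    by (simp add: S_def sum.Sigma sum.cartesian_product)
  also have "\<dots> = (\<Sum>q\<le>p. dehomog q x \<otimes> dehomog (p - q) y)"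
    unfolding dehomog_def mult_sum by (intro sum.cong refl sum.swap)
  finally show ?thesis .
qed

lemma finite_degree:
  assumes "x \<in> carrier Rt"
  obtains M where "\<And>j u. u \<in> Poly_Mapping.keys (x j) \<Longrightarrow> j + path_length u \<le> M"
proof -
  from assms obtain n where n: "\<And>j. j > n \<Longrightarrow> x j = 0" by (auto simp: Rt_carrier)
  \<comment> \<open>A sum of degrees serves as a crude bound for their maximum; vanishing
    coefficients with unspecified degree can only enlarge it.\<close>
  have "j + path_length u \<le> n + (\<Sum>i\<le>n. pdeg (x i))" if u: "u \<in> Poly_Mapping.keys (x j)" for j u
  proof -
    have "j \<le> n" using u n[of j] by (auto simp: not_less[symmetric])
    moreover have "path_length u \<le> pdeg (x j)" using path_length_le_pdeg[OF u] .
    moreover have "pdeg (x j) \<le> (\<Sum>i\<le>n. pdeg (x i))" using \<open>j \<le> n\<close> by (intro member_le_sum) auto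
    ultimately show ?thesis by linarith
  qed
  then show thesis by (rule that)
qed

lemma dehomog_eventually_0:
  assumes "x \<in> carrier Rt"
  shows "\<exists>n. \<forall>p>n. dehomog p x = 0"
proof -
  obtain M where M: "\<And>j u. u \<in> Poly_Mapping.keys (x j) \<Longrightarrow> j + path_length u \<le> M"
    using finite_degree[OF assms] by blast
  have "dehomog p x = 0" if "p > M" for p
    unfolding dehomog_def using that M by (fastforce intro!: sum.neutral hcomp_eq_0)
  then show ?thesis by blast
qed

text \<open>A path \<open>u\<close> in the coefficient of exponent \<open>j\<close> is picked up for
  exactly one \<open>p\<close>, namely \<open>j + path_length u\<close>.\<close>

lemma sum_homogeneous_components:
  assumes "x \<in> carrier Rt"
  obtains M where "x = (\<lambda>j. \<Sum>p\<le>M. homog_at p (dehomog p x) j)"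
proof -
  obtain M where M: "\<And>j u. u \<in> Poly_Mapping.keys (x j) \<Longrightarrow> j + path_length u \<le> M"
    using finite_degree[OF assms] by blast
  have "Poly_Mapping.lookup (\<Sum>p\<le>M. homog_at p (dehomog p x) j) u = Poly_Mapping.lookup (x j) u" for j u
  proof -
    have "Poly_Mapping.lookup (\<Sum>p\<le>M. homog_at p (dehomog p x) j) u =
        (\<Sum>p\<le>M. if p = j + path_length u then Poly_Mapping.lookup (x j) u else 0)"
      unfolding lookup_sum homog_at_dehomog by (intro sum.cong) (auto simp: lookup_hcomp)
    also have "\<dots> = Poly_Mapping.lookup (x j) u" using M[of u j] by (auto simp: in_keys_iff)
    finally show ?thesis .
  qed
  then have "x = (\<lambda>j. \<Sum>p\<le>M. homog_at p (dehomog p x) j)"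
    by (intro ext poly_mapping_eqI) simp
  then show thesis by (rule that)
qed

text \<open>A homogeneous element of degree \<open>p\<close> is recovered from the sum of its
  coefficients, because these have pairwise different degrees.\<close>

lemma poly_grading_eq: "poly_grading R (homogeneous_part Q) p = homog_at p ` below (Suc p)"
proof
  show "poly_grading R (homogeneous_part Q) p \<subseteq> homog_at p ` below (Suc p)"
  proof
    fix x assume "x \<in> poly_grading R (homogeneous_part Q) p"
    then obtain r where x: "x = (\<lambda>j. if j \<le> p then r (p - j) else 0)"
      and r: "\<And>i. r i \<in> carrier R" "\<And>i. \<forall>u\<in>Poly_Mapping.keys (r i). path_length u = i"
      unfolding poly_grading_def homogeneous_part_def zero_eq R_eq[symmetric] by blast
    have "hcomp q (\<Sum>i\<le>p. r i) = r q" if "q \<le> p" for q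
    proof -
      have "hcomp q (r i) = (if i = q then r q else 0)" for i
        using r(2)[of i] by (intro poly_mapping_eqI) (auto simp: lookup_hcomp in_keys_iff)
      then show ?thesis using that by (simp add: hcomp_sum)
    qed
    then have "x = homog_at p (\<Sum>i\<le>p. r i)" by (auto simp: x homog_at_def)
    moreover have "(\<Sum>i\<le>p. r i) \<in> below (Suc p)" using r by (intro sum_below) (auto simp: below_def)
    ultimately show "x \<in> homog_at p ` below (Suc p)" by blast
  qed
  show "homog_at p ` below (Suc p) \<subseteq> poly_grading R (homogeneous_part Q) p"
  proof
    fix x assume "x \<in> homog_at p ` below (Suc p)"
    then obtain f where f: "f \<in> below (Suc p)" "x = homog_at p f" by blast
    have "\<forall>i. hcomp i f \<in> homogeneous_part Q i"
      using below_carrier[OF f(1)] by (auto simp: homogeneous_part_def keys_hcomp hcomp_closed simp flip: R_eq)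
    then show "x \<in> poly_grading R (homogeneous_part Q) p"
      unfolding poly_grading_def f(2) homog_at_def zero_eq
      by (intro CollectI exI[of _ "\<lambda>i. hcomp i f"]) simp
  qed
qed

end

section \<open>The Rees algebra of a quotient\<close>

context path_ideal
begin

text \<open>The total degree is remembered as the position in the sequence; the variable
  \<open>t\<close> goes to the unit placed in degree 1.\<close>

definition rees_map :: "(nat \<Rightarrow> ('v, 'e) path \<Rightarrow>\<^sub>0 'k) \<Rightarrow> nat \<Rightarrow> (('v, 'e) path \<Rightarrow>\<^sub>0 'k) set" where
  "rees_map x = (\<lambda>p. proj (dehomog p x))"

lemma rees_carrier:
  "y \<in> carrier (rees_algebra A FA) \<longleftrightarrow> (\<forall>p. y p \<in> FA p) \<and> (\<exists>n. \<forall>p>n. y p = proj 0)"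
  using FA.F_carrier by (auto simp: rees_algebra_def UP_def FA.mem_up_iff proj_zero)

lemma rees_map_closed: "x \<in> carrier Rt \<Longrightarrow> rees_map x \<in> carrier (rees_algebra A FA)"
  using dehomog_eventually_0[of x] dehomog_below[of x] unfolding rees_carrier rees_map_def FA_eq by fastforce

lemma ring_morphism_rees_map: "ring_morphism Rt (rees_algebra A FA) rees_map"
proof (intro ring_morphism.intro ring_Rt ring_morphism_axioms.intro ring_hom_memI)
  fix x y assume x: "x \<in> carrier Rt" and y: "y \<in> carrier Rt"
  have up: "rees_map x \<in> up A" "rees_map y \<in> up A"
    using rees_map_closed x y by (auto simp: rees_algebra_def UP_def)
  have "(rees_map x \<otimes>\<^bsub>rees_algebra A FA\<^esub> rees_map y) p = rees_map (x \<otimes>\<^bsub>Rt\<^esub> y) p" for p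
  proof -
    have "(rees_map x \<otimes>\<^bsub>rees_algebra A FA\<^esub> rees_map y) p =
        (\<Oplus>\<^bsub>A\<^esub>i\<in>{..p}. proj (dehomog i x \<otimes> dehomog (p - i) y))"
      using up x y by (simp add: rees_algebra_def UP_def rees_map_def proj_mult dehomog_closed)
    also have "\<dots> = proj (\<Sum>i\<le>p. dehomog i x \<otimes> dehomog (p - i) y)"
      using x y by (intro proj_finsum) (auto simp: dehomog_closed)
    finally show ?thesis using x y by (simp add: rees_map_def dehomog_mult)
  qed
  then show "rees_map (x \<otimes>\<^bsub>Rt\<^esub> y) = rees_map x \<otimes>\<^bsub>rees_algebra A FA\<^esub> rees_map y" by auto
  show "rees_map (x \<oplus>\<^bsub>Rt\<^esub> y) = rees_map x \<oplus>\<^bsub>rees_algebra A FA\<^esub> rees_map y"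
    using up x y
    by (simp add: rees_algebra_def UP_def rees_map_def Rt_add dehomog_add proj_add dehomog_closed)
next
  show "rees_map \<one>\<^bsub>Rt\<^esub> = \<one>\<^bsub>rees_algebra A FA\<^esub>"
    by (auto simp: fun_eq_iff rees_algebra_def UP_def rees_map_def dehomog_one proj_one proj_zero)
qed (rule rees_map_closed)

lemma rees_map_homog_at:
  "f \<in> below (Suc p) \<Longrightarrow> rees_map (homog_at p f) = (\<lambda>q. if q = p then proj f else proj 0)"
  by (auto simp: fun_eq_iff rees_map_def dehomog_homog_at)

lemma rees_map_surj:
  assumes "y \<in> carrier (rees_algebra A FA)"
  shows "y \<in> rees_map ` carrier Rt"
proof -
  from assms obtain n where n: "\<And>p. p > n \<Longrightarrow> y p = proj 0" by (auto simp: rees_carrier)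
  have "\<forall>p. \<exists>f\<in>below (Suc p). y p = proj f"
    using assms unfolding rees_carrier FA_eq by blast
  then obtain c where c: "\<And>p. c p \<in> below (Suc p)" "\<And>p. y p = proj (c p)" by metis
  let ?x = "\<lambda>j. \<Sum>p\<le>n. homog_at p (c p) j"
  have "rees_map ?x q = y q" for q
  proof -
    have "dehomog q ?x = (if q \<le> n then c q else 0)"
      using c(1) by (simp add: dehomog_sum dehomog_homog_at)
    then show ?thesis using c(2) n by (simp add: rees_map_def)
  qed
  then have "rees_map ?x = y" by auto
  moreover have "?x \<in> carrier Rt"
    \<comment> \<open>The whole of \<open>R[t]\<close> is an ideal, so closure of ideals under
      finite sums also gives membership in the carrier.\<close>
    using ideal_Rt_sum[OF ring.oneideal[OF ring_Rt], of "{..n}" "\<lambda>p. homog_at p (c p)"]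
      homog_at_closed[OF below_carrier[OF c(1)]] by simp
  ultimately show ?thesis by blast
qed

lemma proj_eq_zero_iff: "x \<in> carrier R \<Longrightarrow> proj x = proj 0 \<longleftrightarrow> x \<in> I"
  using proj_eq_iff[of x 0] by (simp add: zero_carrier)

lemma homogenization_I_closed: "homogenization ` I \<subseteq> carrier Rt"
  using I_carrier by (auto simp: homogenization_closed)

text \<open>An element is in the kernel iff setting \<open>t = 1\<close> in each homogeneous
  component gives an element of \<open>I\<close>. Such a component is a power of \<open>t\<close>
  times the homogenization of that element, and finitely many components add up to the
  whole.\<close>

lemma kern_rees_map: "ring_morphism.kern Rt rees_map = Idl\<^bsub>Rt\<^esub> (homogenization ` I)" (is "?K = ?L")
proof
  interpret RM: ring_morphism Rt "rees_algebra A FA" rees_map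
    by (rule ring_morphism_rees_map)
  have K: "x \<in> ?K \<longleftrightarrow> x \<in> carrier Rt \<and> (\<forall>p. dehomog p x \<in> I)" for x
    unfolding RM.kern_def Rt_zero
    by (simp add: rees_map_def fun_eq_iff dehomog_zero proj_eq_zero_iff dehomog_closed cong: conj_cong)
  have "homogenization ` I \<subseteq> ?K"
    using homogenization_I_closed I_zero below_pdeg[OF I_carrier]
    by (auto simp: K homogenization_eq dehomog_homog_at)
  then show "?L \<subseteq> ?K" using RM.ideal_kern by (intro ring.genideal_minimal[OF ring_Rt])
  have L: "ideal ?L Rt" by (rule ring.genideal_ideal[OF ring_Rt homogenization_I_closed])
  show "?K \<subseteq> ?L"
  proof
    fix x assume x: "x \<in> ?K"
    then have xc: "x \<in> carrier Rt" and xI: "\<And>p. dehomog p x \<in> I" by (auto simp: K)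
    have "homogenization (dehomog p x) \<in> ?L" for p
      using ring.genideal_self[OF ring_Rt homogenization_I_closed] xI by blast
    then have h: "homog_at p (dehomog p x) \<in> ?L" for p
      using L dehomog_closed[OF xc] dehomog_below[OF xc] by (intro homog_at_in_ideal)
    obtain M where M: "x = (\<lambda>j. \<Sum>p\<le>M. homog_at p (dehomog p x) j)"
      using sum_homogeneous_components[OF xc] by blast
    have "(\<lambda>j. \<Sum>p\<le>M. homog_at p (dehomog p x) j) \<in> ?L"
      using h by (intro ideal_Rt_sum[OF L]) auto
    then show "x \<in> ?L" by (simp only: M[symmetric])
  qed
qed

lemma rees_isomorphic:
  "graded_isomorphic (rees_algebra A FA) (rees_part A FA) (quot_algebra Rt (Idl\<^bsub>Rt\<^esub> (homogenization ` I)))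
    (quot_grading Rt (Idl\<^bsub>Rt\<^esub> (homogenization ` I)) (poly_grading R (homogeneous_part Q)))"
proof -
  interpret RM: ring_morphism Rt "rees_algebra A FA" rees_map
    by (rule ring_morphism_rees_map)
  have "graded_isomorphic (rees_algebra A FA) (rees_part A FA) (quot_algebra Rt RM.kern)
     (quot_grading Rt RM.kern (poly_grading R (homogeneous_part Q)))"
  proof (rule RM.graded_isomorphic_quot)
    show "rees_map ` carrier Rt = carrier (rees_algebra A FA)"
      using rees_map_surj rees_map_closed by blast
    fix p
    show "poly_grading R (homogeneous_part Q) p \<subseteq> carrier Rt"
      unfolding poly_grading_eq by (auto intro: homog_at_closed below_carrier)
    show "rees_map ` poly_grading R (homogeneous_part Q) p = rees_part A FA p"
    proof
      show "rees_map ` poly_grading R (homogeneous_part Q) p \<subseteq> rees_part A FA p"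
        using rees_map_closed[OF homog_at_closed[OF below_carrier]]
        by (auto simp: poly_grading_eq rees_part_def rees_map_homog_at proj_zero)
      show "rees_part A FA p \<subseteq> rees_map ` poly_grading R (homogeneous_part Q) p"
      proof
        fix y assume y: "y \<in> rees_part A FA p"
        then have "y p \<in> FA p" by (simp add: rees_part_def rees_carrier)
        then obtain f where f: "f \<in> below (Suc p)" "y p = proj f" unfolding FA_eq by blast
        have "y = rees_map (homog_at p f)"
          using y f by (intro ext) (simp add: rees_map_homog_at rees_part_def proj_zero)
        then show "y \<in> rees_map ` poly_grading R (homogeneous_part Q) p"
          using f(1) unfolding poly_grading_eq by blast
      qed
    qed
  next
    fix c x assume x: "x \<in> carrier Rt"
    then show "c \<odot>\<^bsub>Rt\<^esub> x \<in> carrier Rt"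
      unfolding Rt_smult Rt_carrier by (auto simp: smult_closed smult_zero) (metis smult_zero)
    show "rees_map (c \<odot>\<^bsub>Rt\<^esub> x) = c \<odot>\<^bsub>rees_algebra A FA\<^esub> rees_map x"
      using x by (simp add: Rt_smult rees_map_def dehomog_smult rees_algebra_def proj_smult dehomog_closed)
  qed
  then show ?thesis unfolding kern_rees_map .
qed

end

section \<open>Leading forms, homogenizations and representations of bounded combinations\<close>

context path_ring
begin

lemma hcomp_single_mult:
  "hcomp n (Poly_Mapping.single w c \<otimes> g) =
    (if path_length w \<le> n then Poly_Mapping.single w c \<otimes> hcomp (n - path_length w) g else 0)"
proof -
  have "hcomp n (Poly_Mapping.single w c \<otimes> g) =
      (\<Sum>i\<le>n. if i = path_length w then Poly_Mapping.single w c \<otimes> hcomp (n - path_length w) g else 0)"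
    unfolding hcomp_mult by (intro sum.cong) (auto simp: hcomp_single mult_zero)
  then show ?thesis by simp
qed

lemma hcomp_mult_single:
  "hcomp n (g \<otimes> Poly_Mapping.single s c) =
    (if path_length s \<le> n then hcomp (n - path_length s) g \<otimes> Poly_Mapping.single s c else 0)"
proof -
  have "hcomp n (g \<otimes> Poly_Mapping.single s c) =
      (\<Sum>i\<le>n. if i = n - path_length s then if path_length s \<le> n then hcomp (n - path_length s) g \<otimes> Poly_Mapping.single s c else 0 else 0)"
    unfolding hcomp_mult by (intro sum.cong) (auto simp: hcomp_single mult_zero)
  then show ?thesis by simp
qed

lemma hcomp_sandwich:
  "hcomp n (Poly_Mapping.single w c \<otimes> g \<otimes> Poly_Mapping.single s d) =
    (if path_length w + path_length s \<le> n
     then Poly_Mapping.single w c \<otimes> hcomp (n - (path_length w + path_length s)) g \<otimes> Poly_Mapping.single s d else 0)"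
  by (auto simp: hcomp_mult_single hcomp_single_mult mult_zero add.commute)

text \<open>In degree \<open>p\<close> a summand contributes \<open>c w g' s\<close> with
  \<open>g'\<close> a component of \<open>g\<close>: the leading form of \<open>g\<close> if the
  degree bound is attained, and zero if it is not.\<close>

lemma bounded_comb_hcomp:
  assumes "G \<subseteq> carrier R" "f \<in> bounded_comb G p"
  shows "hcomp p f \<in> Idl (LH ` G)"
  using assms(2)
proof induction
  have LHc: "LH ` G \<subseteq> carrier R" using assms(1) by (auto simp: LH_def hcomp_closed zero_carrier)
  have L: "ideal (Idl (LH ` G)) R" by (rule genideal_ideal[OF LHc])
  case zero
  show ?case using ideal_zero[OF L] by (simp add: hcomp_zero)
next
  have LHc: "LH ` G \<subseteq> carrier R" using assms(1) by (auto simp: LH_def hcomp_closed zero_carrier)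
  have L: "ideal (Idl (LH ` G)) R" by (rule genideal_ideal[OF LHc])
  case (step f g w s c)
  let ?n = "p - (path_length w + path_length s)"
  have "hcomp ?n g \<in> Idl (LH ` G)"
  proof (cases "?n = pdeg g")
    case True
    then have "hcomp ?n g = LH g" using step by (simp add: LH_def)
    then show ?thesis using genideal_self[OF LHc] step by auto
  next
    case False
    then have "hcomp ?n g = 0"
      using step assms(1) by (intro hcomp_below_eq_0[OF below_pdeg]) auto
    then show ?thesis using ideal_zero[OF L] by simp
  qed
  then have "Poly_Mapping.single w c \<otimes> hcomp ?n g \<otimes> Poly_Mapping.single s 1 \<in> Idl (LH ` G)"
    using step by (intro ideal.I_l_closed[OF L] ideal.I_r_closed[OF L] single_closed)
  then have "hcomp p (Poly_Mapping.single w c \<otimes> g \<otimes> Poly_Mapping.single s 1) \<in> Idl (LH ` G)"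
    using ideal_zero[OF L] by (simp add: hcomp_sandwich)
  then show ?case
    using additive_subgroup.a_closed[OF ideal.axioms(1)[OF L]] step.IH by (simp add: hcomp_add add_eq)
qed

lemma bounded_comb_genideal:
  assumes "G \<subseteq> carrier R" "f \<in> bounded_comb G p"
  shows "f \<in> Idl G"
  using assms(2)
proof induction
  case zero
  show ?case using ideal_zero[OF genideal_ideal[OF assms(1)]] .
next
  have L: "ideal (Idl G) R" by (rule genideal_ideal[OF assms(1)])
  case (step f g w s c)
  have "g \<in> Idl G" using genideal_self[OF assms(1)] step by blast
  then have "Poly_Mapping.single w c \<otimes> g \<otimes> Poly_Mapping.single s 1 \<in> Idl G"
    using step by (intro ideal.I_l_closed[OF L] ideal.I_r_closed[OF L] single_closed)
  then show ?case
    using additive_subgroup.a_closed[OF ideal.axioms(1)[OF L]] step.IH by (simp add: add_eq)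
qed

text \<open>The exponent on the left is the slack in the degree bound: homogenizing to degree
  \<open>p\<close> fills the missing degree with powers of \<open>t\<close>.\<close>

lemma homog_at_sandwich:
  assumes g: "g \<in> carrier R" and ws: "w \<in> paths Q" "s \<in> paths Q"
    and q: "path_length w + pdeg g + path_length s \<le> p"
  shows "homog_at p (Poly_Mapping.single w c \<otimes> g \<otimes> Poly_Mapping.single s 1) =
    coeff_elem (Poly_Mapping.single w c) (p - (path_length w + pdeg g + path_length s)) \<otimes>\<^bsub>Rt\<^esub> homogenization g
      \<otimes>\<^bsub>Rt\<^esub> coeff_elem (Poly_Mapping.single s 1) 0" (is "?l = ?a \<otimes>\<^bsub>Rt\<^esub> _ \<otimes>\<^bsub>Rt\<^esub> ?b")
proof
  fix j
  interpret Rt: ring Rt by (rule ring_Rt)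
  let ?k = "p - (path_length w + pdeg g + path_length s)"
  note cl = homogenization_closed[OF g] coeff_elem_closed[OF single_closed[OF ws(1)]]
  have r: "(?a \<otimes>\<^bsub>Rt\<^esub> homogenization g \<otimes>\<^bsub>Rt\<^esub> ?b) j =
      (if ?k \<le> j then Poly_Mapping.single w c \<otimes> homogenization g (j - ?k) else 0) \<otimes> Poly_Mapping.single s 1"
    by (subst mult_coeff_elem[OF single_closed[OF ws(2)] Rt.m_closed[OF cl(2,1)]])
      (simp only: coeff_elem_mult[OF single_closed[OF ws(1)] cl(1)])
  have z: "hcomp n g = 0" if "pdeg g < n" for n
    using that by (intro hcomp_below_eq_0[OF below_pdeg[OF g]]) simp
  \<comment> \<open>The cases are exponents below the slack, exponents hitting the homogenization of
    \<open>g\<close>, and exponents beyond it. Both sides vanish in the outer cases; in the middle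
    one the truncated subtractions are exact.\<close>
  consider "j < ?k" | "?k \<le> j" "j - ?k \<le> pdeg g" | "?k \<le> j" "pdeg g < j - ?k" by linarith
  then show "?l j = (?a \<otimes>\<^bsub>Rt\<^esub> homogenization g \<otimes>\<^bsub>Rt\<^esub> ?b) j"
  proof cases
    case 1
    then have "hcomp (p - j - (path_length w + path_length s)) g = 0" by (intro z) linarith
    then show ?thesis using 1 unfolding r by (simp add: homogenization_eq homog_at_def hcomp_sandwich mult_zero)
  next
    case 2
    then have "j \<le> p" "path_length w + path_length s \<le> p - j"
      "p - j - (path_length w + path_length s) = pdeg g - (j - ?k)"
      using q by linarith+
    then show ?thesis using 2 unfolding r by (simp add: homogenization_eq homog_at_def hcomp_sandwich)
  next
    case 3
    then have "\<not> (j \<le> p \<and> path_length w + path_length s \<le> p - j)" using q by linarith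
    then show ?thesis using 3 unfolding r by (auto simp: homogenization_eq homog_at_def hcomp_sandwich mult_zero)
  qed
qed

lemma bounded_comb_homog_at:
  assumes "G \<subseteq> carrier R" "f \<in> bounded_comb G p"
  shows "homog_at p f \<in> Idl\<^bsub>Rt\<^esub> (homogenization ` G)"
  using assms(2)
proof induction
  have c: "homogenization ` G \<subseteq> carrier Rt" using assms(1) by (auto simp: homogenization_closed)
  case zero
  show ?case using ideal_Rt_zero[OF ring.genideal_ideal[OF ring_Rt c]] by (simp add: homog_at_zero)
next
  have c: "homogenization ` G \<subseteq> carrier Rt" using assms(1) by (auto simp: homogenization_closed)
  have L: "ideal (Idl\<^bsub>Rt\<^esub> (homogenization ` G)) Rt" by (rule ring.genideal_ideal[OF ring_Rt c])
  case (step f g w s a)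
  have "homogenization g \<in> Idl\<^bsub>Rt\<^esub> (homogenization ` G)"
    using ring.genideal_self[OF ring_Rt c] step by blast
  moreover have "g \<in> carrier R" using step assms(1) by blast
  ultimately have "homog_at p (Poly_Mapping.single w a \<otimes> g \<otimes> Poly_Mapping.single s 1) \<in> Idl\<^bsub>Rt\<^esub> (homogenization ` G)"
    using step
    by (simp add: homog_at_sandwich ideal.I_l_closed[OF L] ideal.I_r_closed[OF L] coeff_elem_closed single_closed)
  then show ?case unfolding homog_at_add using ideal_Rt_add[OF L] step.IH by blast
qed

lemma bounded_comb_representation:
  assumes "G \<subseteq> carrier R" "f \<in> bounded_comb G p"
  shows "\<exists>n::nat. \<exists>g \<phi> h. (\<forall>j<n. g j \<in> carrier R \<and> \<phi> j \<in> G \<and> h j \<in> carrier R) \<and>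
    f = (\<Oplus>j\<in>{..<n}. g j \<otimes> \<phi> j \<otimes> h j) \<and>
    (\<forall>j<n. g j \<otimes> \<phi> j \<otimes> h j \<noteq> \<zero> \<longrightarrow> pdeg (g j) + pdeg (\<phi> j) + pdeg (h j) \<le> p)"
  using assms(2)
proof induction
  case zero
  show ?case by (rule exI[of _ 0]) (simp add: zero_eq)
next
  case (step f \<gamma> w s c)
  from step.IH obtain n :: nat and g \<phi> h where
    cl: "\<And>j. j < n \<Longrightarrow> g j \<in> carrier R \<and> \<phi> j \<in> G \<and> h j \<in> carrier R"
    and f: "f = (\<Oplus>j\<in>{..<n}. g j \<otimes> \<phi> j \<otimes> h j)"
    and deg: "\<And>j. j < n \<Longrightarrow> g j \<otimes> \<phi> j \<otimes> h j \<noteq> \<zero> \<Longrightarrow> pdeg (g j) + pdeg (\<phi> j) + pdeg (h j) \<le> p"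
    by blast
  define g' where "g' = g(n := Poly_Mapping.single w c)"
  define \<phi>' where "\<phi>' = \<phi>(n := \<gamma>)"
  define h' where "h' = h(n := Poly_Mapping.single s (1::'k))"
  have cl': "g' j \<in> carrier R \<and> \<phi>' j \<in> G \<and> h' j \<in> carrier R" if "j < Suc n" for j
    using that cl step by (auto simp: g'_def \<phi>'_def h'_def less_Suc_eq single_closed)
  have summand: "g' j \<otimes> \<phi>' j \<otimes> h' j \<in> carrier R" if "j < Suc n" for j
    using cl'[OF that] assms(1) by auto
  have "(\<Oplus>j\<in>{..<Suc n}. g' j \<otimes> \<phi>' j \<otimes> h' j) = (\<Sum>j<Suc n. g' j \<otimes> \<phi>' j \<otimes> h' j)"
    using summand by (intro finsum_eq_sum) auto
  also have "\<dots> = (\<Sum>j<n. g j \<otimes> \<phi> j \<otimes> h j) + Poly_Mapping.single w c \<otimes> \<gamma> \<otimes> Poly_Mapping.single s 1"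
    by (simp add: g'_def \<phi>'_def h'_def)
  also have "(\<Sum>j<n. g j \<otimes> \<phi> j \<otimes> h j) = f"
    unfolding f using cl assms(1) by (intro finsum_eq_sum[symmetric]) auto
  finally have sum: "Poly_Mapping.single w c \<otimes> \<gamma> \<otimes> Poly_Mapping.single s 1 + f =
      (\<Oplus>j\<in>{..<Suc n}. g' j \<otimes> \<phi>' j \<otimes> h' j)" by simp
  have pd: "pdeg (Poly_Mapping.single u a) = path_length u" if "a \<noteq> 0" for u :: "('v, 'e) path" and a :: 'k
    using that by (simp add: pdeg_def)
  have "pdeg (g' j) + pdeg (\<phi>' j) + pdeg (h' j) \<le> p" if "j < Suc n" "g' j \<otimes> \<phi>' j \<otimes> h' j \<noteq> \<zero>" for j
  proof (cases "j = n")
    case True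
    \<comment> \<open>A zero scalar makes the summand zero, for which no bound is claimed; a nonzero
      one gives \<open>Poly_Mapping.single w c\<close> the degree
      \<open>path_length w\<close>.\<close>
    then have "c \<noteq> 0" using that by (auto simp: g'_def mult_zero zero_eq)
    then show ?thesis using True step by (simp add: g'_def \<phi>'_def h'_def pd)
  next
    case False
    then show ?thesis using that deg[of j] by (simp add: g'_def \<phi>'_def h'_def)
  qed
  then show ?case using cl' sum by blast
qed

end

theorem theorem2p1:
  fixes Q :: "('v, 'e) pre_digraph"
    and r :: "('v, 'e) path rel"
    and I \<G> :: "(('v, 'e) path \<Rightarrow>\<^sub>0 'k::field) set"
  defines "R \<equiv> path_algebra Q :: ('k, ('v, 'e) path \<Rightarrow>\<^sub>0 'k) module"
    and "Rt \<equiv> poly_algebra (path_algebra Q :: ('k, ('v, 'e) path \<Rightarrow>\<^sub>0 'k) module)"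
    and "A \<equiv> quot_algebra (path_algebra Q) I"
    and "FA \<equiv> quot_filtration Q I"
  assumes "fin_digraph Q"
    and "graded_monomial_ordering Q r"
    and "ideal I R"
    and "groebner_basis Q r I \<G>"
  shows "(Idl\<^bsub>R\<^esub> (LH ` I) = Idl\<^bsub>R\<^esub> (LH ` \<G>) \<and>
          graded_isomorphic (assoc_graded A FA) (assoc_graded_part A FA)
            (quot_algebra R (Idl\<^bsub>R\<^esub> (LH ` \<G>)))
            (quot_grading R (Idl\<^bsub>R\<^esub> (LH ` \<G>)) (homogeneous_part Q)) \<and>
          general_PBW Q I \<G>) \<and>
         (Idl\<^bsub>Rt\<^esub> (homogenization ` I) = Idl\<^bsub>Rt\<^esub> (homogenization ` \<G>) \<and>
          graded_isomorphic (rees_algebra A FA) (rees_part A FA)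
            (quot_algebra Rt (Idl\<^bsub>Rt\<^esub> (homogenization ` \<G>)))
            (quot_grading Rt (Idl\<^bsub>Rt\<^esub> (homogenization ` \<G>)) (poly_grading R (homogeneous_part Q))))"
proof -
  have pr: "path_ring Q R" using assms(5) by (simp add: path_ring_def R_def)
  interpret monomial_ordering Q R r
    using pr assms(6) by (simp add: monomial_ordering_def monomial_ordering_axioms_def)
  interpret J: path_ideal Q R I
    using pr assms(7) by (simp add: path_ideal_def path_ideal_axioms_def)
  have Rt: "Rt = poly_algebra R" and A: "A = quot_algebra R I" by (simp_all add: Rt_def A_def R_def)
  interpret Rt: ring Rt unfolding Rt by (rule ring_Rt)
  have sub: "\<G> \<subseteq> I" using assms(8) by (simp add: groebner_basis_def)
  then have Gc: "\<G> \<subseteq> carrier R" using J.I_carrier by blast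
  \<comment> \<open>For \<open>f = 0\<close> the bound \<open>pdeg f\<close> is unspecified, but
    zero is a bounded combination for every bound.\<close>
  have comb: "f \<in> bounded_comb \<G> (pdeg f)" if "f \<in> I" for f
    using groebner_bounded_comb[OF assms(7,8) that] bounded_comb.zero by (cases "f = 0") auto
  have Ic: "I \<subseteq> carrier R" using J.I_carrier by blast
  have LHc: "LH ` S \<subseteq> carrier R" if "S \<subseteq> carrier R" for S
    using that by (auto simp: LH_def hcomp_closed zero_carrier)
  have Hc: "homogenization ` S \<subseteq> carrier Rt" if "S \<subseteq> carrier R" for S
    using that by (auto simp: Rt homogenization_closed)
  \<comment> \<open>With the bound equal to \<open>pdeg f\<close>, the component of that degree is
    \<open>LH f\<close>; likewise \<open>homog_at\<close> at this degree is the homogenization used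
    for part (ii).\<close>
  have "LH f \<in> Idl\<^bsub>R\<^esub> (LH ` \<G>)" if "f \<in> I" for f
    using bounded_comb_hcomp[OF Gc comb[OF that]] ideal_zero[OF genideal_ideal[OF LHc[OF Gc]]]
    by (simp add: LH_def)
  then have LHeq: "Idl\<^bsub>R\<^esub> (LH ` I) = Idl\<^bsub>R\<^esub> (LH ` \<G>)"
    by (intro equalityI genideal_minimal genideal_ideal LHc Gc Ic image_subsetI
        subset_trans[OF image_mono[OF sub] genideal_self])
  have "homogenization f \<in> Idl\<^bsub>Rt\<^esub> (homogenization ` \<G>)" if "f \<in> I" for f
    using bounded_comb_homog_at[OF Gc comb[OF that]] by (simp add: homogenization_eq Rt)
  then have Heq: "Idl\<^bsub>Rt\<^esub> (homogenization ` I) = Idl\<^bsub>Rt\<^esub> (homogenization ` \<G>)"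
    by (intro equalityI Rt.genideal_minimal Rt.genideal_ideal Hc Gc Ic image_subsetI
        subset_trans[OF image_mono[OF sub] Rt.genideal_self])
  have Geq: "Idl\<^bsub>R\<^esub> \<G> = I"
    using genideal_minimal[OF assms(7) sub] bounded_comb_genideal[OF Gc comb] by blast
  have rho: "natural_rho Q I \<in> graded_iso (quot_algebra R (Idl\<^bsub>R\<^esub> (LH ` \<G>)))
      (quot_grading R (Idl\<^bsub>R\<^esub> (LH ` \<G>)) (homogeneous_part Q)) (assoc_graded A FA) (assoc_graded_part A FA)"
    using J.natural_rho_iso by (simp add: LHeq A FA_def)
  have assoc: "graded_isomorphic (assoc_graded A FA) (assoc_graded_part A FA)
      (quot_algebra R (Idl\<^bsub>R\<^esub> (LH ` \<G>))) (quot_grading R (Idl\<^bsub>R\<^esub> (LH ` \<G>)) (homogeneous_part Q))"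
    using J.assoc_graded_isomorphic by (simp add: LHeq A FA_def)
  have rees: "graded_isomorphic (rees_algebra A FA) (rees_part A FA)
      (quot_algebra Rt (Idl\<^bsub>Rt\<^esub> (homogenization ` \<G>)))
      (quot_grading Rt (Idl\<^bsub>Rt\<^esub> (homogenization ` \<G>)) (poly_grading R (homogeneous_part Q)))"
    using J.rees_isomorphic by (simp add: A FA_def flip: Heq) (simp add: Rt)
  have "general_PBW Q I \<G>"
    unfolding general_PBW_def Let_def R_def[symmetric] Rt[symmetric] A[symmetric] FA_def[symmetric]
    using Geq rho LHeq Heq bounded_comb_representation[OF Gc comb] by blast
  then show ?thesis using LHeq assoc Heq rees by blast
qed

end
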